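(* The circuit equivalence problem for $\mathrm{CC}[2,3,2]$-circuits can be polytime-reduced to the following problem: given $k,n\in\mathbb{N}$ and expanded polynomials $p_1,\dots,p_k\in\mathbb{Z}_3[x_1,\dots,x_n]$, decide whether $\sum_{i=1}^k\alpha^{p_i(\mathbf{a})}=0$ for all $\mathbf{a}\in\{-1,1\}^n$.
   Context: $\alpha$ is a primitive element of the field $\mathbb{F}_4$; since $\alpha^3=1$, $\alpha^t$ is defined for $t\in\mathbb{Z}_3$; $p_i(\mathbf{a})$ is computed in $\mathbb{Z}_3$ and the sum in $\mathbb{F}_4$. An expanded polynomial is given as $\sum_{\mathbf{e}\in I}c_{\mathbf{e}}x_1^{e_1}\cdots x_n^{e_n}$ with $I\subseteq\{0,1,2\}^n$ and $c_{\mathbf{e}}\in\mathbb{Z}_3\setminus\{0\}$. A $\mathrm{CC}[2,3,2]$-circuit on inputs $y_1,\dots,y_n\in\{0,1\}$ is a depth-3 circuit with unbounded fan-in $\mathrm{MOD}_2$, $\mathrm{MOD}_3$, $\mathrm{MOD}_2$ gates at depths $1,2,3$ (a $\mathrm{MOD}_m$ gate outputs $1$ iff the sum of its inputs, with multiplicity, is divisible by $m$, else $0$), some input wires possibly constant $1$; equivalently an expression $\mathrm{Mod}_2\big(c_0+\sum_{i=1}^k\mathrm{Mod}_3\big(c_1(i)+\sum_{j=1}^{l(i)}\mathrm{Mod}_2(c_2(i,j)+\sum_{m=1}^n e(i,j,m)y_m)\big)\big)$ with nonnegative integer constants, $\mathrm{Mod}_r(z)=1$ iff $r\mid z$. Its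 size is the number of gates. The circuit equivalence problem asks, given such a circuit $C$, whether $C$ evaluates to $1$ on every input vector. Polytime-reducible: there is a polynomial-time transformation $P$ of inputs with $A(e)\iff B(P(e))$. *)

theory Defs
  imports "HOL-Computational_Algebra.Polynomial"
begin

text \<open>
  Deterministic multi-tape Turing machines with two-way infinite tapes. Tape symbols are
  \<open>0, \<dots>, num_syms - 1\<close>, where \<open>0\<close> is the blank; states are \<open>0, \<dots>, halt_state\<close>, where \<open>0\<close> is the
  start state. The transition table maps a state and the list of scanned symbols (one per tape)
  to the next state, the symbols written, and the head moves. By \<open>wf_tm\<close> only a finite part of
  it matters.
\<close>

record tm =
  num_tapes :: nat
  num_syms :: nat
  halt_state :: nat
  delta :: "nat \<Rightarrow> nat list \<Rightarrow> nat \<times> nat list \<times> int list"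

definition wf_tm :: "tm \<Rightarrow> bool" where
  "wf_tm M \<longleftrightarrow> num_tapes M \<ge> 1 \<and> num_syms M \<ge> 1 \<and>
     (\<forall>q < halt_state M. \<forall>v. length v = num_tapes M \<and> set v \<subseteq> {..<num_syms M} \<longrightarrow>
        (case delta M q v of (q', w, d) \<Rightarrow>
           q' \<le> halt_state M \<and>
           length w = num_tapes M \<and> set w \<subseteq> {..<num_syms M} \<and>
           length d = num_tapes M \<and> set d \<subseteq> {-1, 0, 1}))"

text \<open>A tape is its head position together with its contents.\<close>

type_synonym tape = "int \<times> (int \<Rightarrow> nat)"
type_synonym config = "nat \<times> tape list"

definition scanned :: "tape \<Rightarrow> nat" where
  "scanned T = snd T (fst T)"

definition act :: "tape \<Rightarrow> nat \<Rightarrow> int \<Rightarrow> tape" where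
  "act T s d = (fst T + d, (snd T)(fst T := s))"

definition step :: "tm \<Rightarrow> config \<Rightarrow> config" where
  "step M = (\<lambda>(q, Ts).
     if q = halt_state M then (q, Ts)
     else (case delta M q (map scanned Ts) of (q', w, d) \<Rightarrow>
       (q', map (\<lambda>i. act (Ts ! i) (w ! i) (d ! i)) [0..<num_tapes M])))"

definition word_tape :: "nat list \<Rightarrow> tape" where
  "word_tape x = (0, \<lambda>z. if 0 \<le> z \<and> z < int (length x) then x ! nat z else 0)"

definition init :: "tm \<Rightarrow> nat list \<Rightarrow> config" where
  "init M x = (0, word_tape x # replicate (num_tapes M - 1) (word_tape []))"

text \<open>The word on a tape extends from the head position to the right, up to the first blank.\<close>

definition tape_word :: "tape \<Rightarrow> nat list \<Rightarrow> bool" where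
  "tape_word T y \<longleftrightarrow>
     (\<forall>j < length y. snd T (fst T + int j) = y ! j \<and> y ! j \<noteq> 0) \<and>
     snd T (fst T + int (length y)) = 0"

text \<open>
  Input is on the first tape, output on the last one. As a halted configuration is a fixed
  point of \<open>step\<close>, the following says that the machine halts within \<open>t\<close> steps.
\<close>

definition computes_within :: "tm \<Rightarrow> nat list \<Rightarrow> nat list \<Rightarrow> nat \<Rightarrow> bool" where
  "computes_within M x y t \<longleftrightarrow>
     set x \<subseteq> {1..<num_syms M} \<and>
     (case (step M ^^ t) (init M x) of (q, Ts) \<Rightarrow> q = halt_state M \<and> tape_word (last Ts) y)"

record 'a decision_problem =
  instances :: "'a set"
  encode :: "'a \<Rightarrow> nat list"
  holds :: "'a \<Rightarrow> bool"

definition polytime_transformation ::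
  "'a decision_problem \<Rightarrow> 'b decision_problem \<Rightarrow> ('a \<Rightarrow> 'b) \<Rightarrow> bool" where
  "polytime_transformation A B P \<longleftrightarrow>
     (\<forall>e \<in> instances A. P e \<in> instances B) \<and>
     (\<exists>M (b :: nat poly). wf_tm M \<and>
        (\<forall>e \<in> instances A.
           computes_within M (encode A e) (encode B (P e)) (poly b (length (encode A e)))))"

definition polytime_reducible :: "'a decision_problem \<Rightarrow> 'b decision_problem \<Rightarrow> bool" where
  "polytime_reducible A B \<longleftrightarrow>
     (\<exists>P. polytime_transformation A B P \<and> (\<forall>e \<in> instances A. holds A e \<longleftrightarrow> holds B (P e)))"

text \<open>
  Instances are written with the symbols \<open>1\<close>, \<open>2\<close> (binary digits zero and one), \<open>3\<close> (end of
  number), \<open>4\<close> and \<open>5\<close> (opening and closing bracket). Numbers are in binary, least significant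
  digit first.
\<close>

fun bits :: "nat \<Rightarrow> nat list" where
  "bits n = (if n = 0 then [] else (1 + n mod 2) # bits (n div 2))"

declare bits.simps [simp del]

definition enc_nat :: "nat \<Rightarrow> nat list" where
  "enc_nat n = bits n @ [3]"

definition enc_list :: "('a \<Rightarrow> nat list) \<Rightarrow> 'a list \<Rightarrow> nat list" where
  "enc_list f xs = [4] @ concat (map f xs) @ [5]"

text \<open>
  The circuit \<open>Circuit n c0 [\<dots>, Gate2 (c1 i) [\<dots>, Gate1 (c2 i j) [e i j 1, \<dots>, e i j n], \<dots>], \<dots>]\<close>
  on \<open>n\<close> inputs stands for
  \<open>Mod 2 (c0 + (\<Sum>i. Mod 3 (c1 i + (\<Sum>j. Mod 2 (c2 i j + (\<Sum>m. e i j m * y m))))))\<close>.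
  The additive constants count the wires that carry the constant \<open>1\<close>, and \<open>e i j m\<close> is the
  multiplicity of the wire from input \<open>m\<close>.
\<close>

datatype gate1 = Gate1 nat "nat list"
datatype gate2 = Gate2 nat "gate1 list"
datatype circuit = Circuit nat nat "gate2 list"

definition Mod :: "nat \<Rightarrow> nat \<Rightarrow> nat" where
  "Mod r z = (if r dvd z then 1 else 0)"

fun eval_gate1 :: "nat list \<Rightarrow> gate1 \<Rightarrow> nat" where
  "eval_gate1 y (Gate1 c es) = Mod 2 (c + (\<Sum>m<length es. es ! m * y ! m))"

fun eval_gate2 :: "nat list \<Rightarrow> gate2 \<Rightarrow> nat" where
  "eval_gate2 y (Gate2 c gs) = Mod 3 (c + (\<Sum>g\<leftarrow>gs. eval_gate1 y g))"

fun eval_circuit :: "nat list \<Rightarrow> circuit \<Rightarrow> nat" where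
  "eval_circuit y (Circuit n c gs) = Mod 2 (c + (\<Sum>g\<leftarrow>gs. eval_gate2 y g))"

fun num_inputs :: "circuit \<Rightarrow> nat" where
  "num_inputs (Circuit n c gs) = n"

fun wf_gate1 :: "nat \<Rightarrow> gate1 \<Rightarrow> bool" where
  "wf_gate1 n (Gate1 c es) \<longleftrightarrow> length es = n"

fun wf_gate2 :: "nat \<Rightarrow> gate2 \<Rightarrow> bool" where
  "wf_gate2 n (Gate2 c gs) \<longleftrightarrow> (\<forall>g \<in> set gs. wf_gate1 n g)"

fun wf_circuit :: "circuit \<Rightarrow> bool" where
  "wf_circuit (Circuit n c gs) \<longleftrightarrow> (\<forall>g \<in> set gs. wf_gate2 n g)"

fun enc_gate1 :: "gate1 \<Rightarrow> nat list" where
  "enc_gate1 (Gate1 c es) = enc_nat c @ enc_list enc_nat es"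

fun enc_gate2 :: "gate2 \<Rightarrow> nat list" where
  "enc_gate2 (Gate2 c gs) = enc_nat c @ enc_list enc_gate1 gs"

fun enc_circuit :: "circuit \<Rightarrow> nat list" where
  "enc_circuit (Circuit n c gs) = enc_nat n @ enc_nat c @ enc_list enc_gate2 gs"

definition cc232_equivalence :: "circuit decision_problem" where
  "cc232_equivalence =
     \<lparr> instances = {C. wf_circuit C},
       encode = enc_circuit,
       holds = (\<lambda>C. \<forall>y. length y = num_inputs C \<and> set y \<subseteq> {0, 1} \<longrightarrow> eval_circuit y C = 1) \<rparr>"

text \<open>
  An expanded polynomial over the integers modulo 3 is the list of its monomials, each given by
  its coefficient and exponent vector. The nonzero coefficients are represented by \<open>1\<close> and \<open>2\<close>.
\<close>

type_synonym expanded_poly = "(nat \<times> nat list) list"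

definition wf_expanded :: "nat \<Rightarrow> expanded_poly \<Rightarrow> bool" where
  "wf_expanded n p \<longleftrightarrow>
     distinct (map snd p) \<and>
     (\<forall>(c, es) \<in> set p. c \<in> {1, 2} \<and> length es = n \<and> set es \<subseteq> {0, 1, 2})"

definition eval_expanded :: "expanded_poly \<Rightarrow> int list \<Rightarrow> int" where
  "eval_expanded p a = (\<Sum>(c, es)\<leftarrow>p. int c * (\<Prod>m<length es. a ! m ^ (es ! m))) mod 3"

definition enc_monomial :: "nat \<times> nat list \<Rightarrow> nat list" where
  "enc_monomial = (\<lambda>(c, es). enc_nat c @ enc_list enc_nat es)"

definition enc_poly_system :: "nat \<times> expanded_poly list \<Rightarrow> nat list" where
  "enc_poly_system = (\<lambda>(n, ps). enc_nat n @ enc_list (enc_list enc_monomial) ps)"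

definition primitive_element :: "'f::field \<Rightarrow> bool" where
  "primitive_element \<alpha> \<longleftrightarrow> {\<alpha> ^ i |i :: nat. True} = UNIV - {0}"

text \<open>An instance \<open>(n, ps)\<close> consists of \<open>k = length ps\<close> polynomials in \<open>n\<close> variables.\<close>

definition poly_exp_sum_zero :: "'f::field \<Rightarrow> (nat \<times> expanded_poly list) decision_problem" where
  "poly_exp_sum_zero \<alpha> =
     \<lparr> instances = {(n, ps). \<forall>p \<in> set ps. wf_expanded n p},
       encode = enc_poly_system,
       holds = (\<lambda>(n, ps). \<forall>a. length a = n \<and> set a \<subseteq> {-1, 1} \<longrightarrow>
                  (\<Sum>p\<leftarrow>ps. \<alpha> ^ nat (eval_expanded p a)) = 0) \<rparr>"

end

theory Submission
  imports Defs
begin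

text \<open>
  Over the field with four elements, \<open>Mod 3 z = 1 + \<alpha>\<^sup>z + \<alpha>\<^bsup>2z\<^esup>\<close>, and the output gate is \<open>1\<close> iff
  \<open>c0\<close> plus the sum of its other inputs vanishes in characteristic \<open>2\<close>. Substituting \<open>a = (-1)\<^sup>y\<close>,
  a gate at depth 1 becomes \<open>2 + 2 * (-1)\<^sup>c * (\<Prod>m. a m ^ (e m mod 2))\<close> modulo 3, so
  the exponents \<open>z\<close> and \<open>2z\<close> are sums of monomials in \<open>a\<close>. Instead of collecting equal monomials,
  we multiply each one by squares of dummy variables, which are \<open>1\<close> on \<open>\<plusminus>1\<close> and encode
  a serial number. The numbers of ordinary and of dummy variables are both twice the length of the
  input; this keeps the output polynomial even if no gate refers to the variables and their number,
  which is given in binary, is exponential. The resulting transformation reads its input from left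
  to right, twice, and is programmed in a small language of while programs that is compiled to
  Turing machines.
\<close>

section \<open>A structured programming language for Turing machines\<close>

text \<open>
  The cells to the left of the head, nearest first, and those from the head on to the right;
  all cells beyond the two lists are blank.
\<close>

type_synonym zipper = "nat list \<times> nat list"

section \<open>Tapes as pairs of finite lists\<close>

definition nth0 :: "nat list \<Rightarrow> nat \<Rightarrow> nat" where
  "nth0 xs i = (if i < length xs then xs ! i else 0)"

lemma nth0_simps [simp]:
  "nth0 [] i = 0" "nth0 (x # xs) 0 = x" "nth0 (x # xs) (Suc i) = nth0 xs i"
  by (simp_all add: nth0_def)

fun zscan :: "zipper \<Rightarrow> nat" where
  "zscan (l, r) = nth0 r 0"

fun zact :: "zipper \<Rightarrow> nat \<Rightarrow> int \<Rightarrow> zipper" where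
  "zact (l, r) s d =
     (if d = 1 then (s # l, tl r)
      else if d = -1 then (tl l, nth0 l 0 # s # tl r)
      else (l, s # tl r))"

text \<open>The absolute head position is dropped: only cells relative to the head are compared, so
  a move works at the ends of the two lists.\<close>

definition represents :: "tape \<Rightarrow> zipper \<Rightarrow> bool" where
  "represents T z \<longleftrightarrow>
     (\<forall>i. snd T (fst T + int i) = nth0 (snd z) i) \<and>
     (\<forall>i. snd T (fst T - 1 - int i) = nth0 (fst z) i)"

lemma nth0_tl: "nth0 (tl xs) i = nth0 xs (Suc i)"
  by (cases xs) auto

lemma represents_scanned: "represents T z \<Longrightarrow> scanned T = zscan z"
  unfolding represents_def scanned_def by (cases z) (metis add.right_neutral of_nat_0 snd_conv zscan.simps)

lemma represents_act:
  assumes "represents T z" and "d \<in> {-1, 0, 1}"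
  shows "represents (act T s d) (zact z s d)"
proof -
  obtain l r where z: "z = (l, r)" by (cases z)
  obtain h f where T: "T = (h, f)" by (cases T)
  have R: "f (h + int i) = nth0 r i" and L: "f (h - 1 - int i) = nth0 l i" for i
    using assms(1) by (auto simp: represents_def z T)
  have R': "f (h + 1 + int i) = nth0 r (Suc i)" for i
    using R[of "Suc i"] by (simp add: algebra_simps)
  have L': "f (h - 2 - int i) = nth0 l (Suc i)" for i
    using L[of "Suc i"] by (simp add: algebra_simps)
  have L0: "f (h - 1) = nth0 l 0" using L[of 0] by simp
  consider "d = 1" | "d = -1" | "d = 0" using assms(2) by auto
  then show ?thesis
  proof cases
    case 1
    have "(f(h := s)) (h - int i) = nth0 (s # l) i" for i
      using L by (cases i) (auto simp: algebra_simps)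
    then show ?thesis
      using 1 R' by (auto simp: represents_def z T act_def nth0_tl)
  next
    case 2
    have "(f(h := s)) (h - 1 + int i) = nth0 (nth0 l 0 # s # tl r) i" for i
    proof (cases i)
      case (Suc j)
      then show ?thesis using R' by (cases j) (auto simp: nth0_tl algebra_simps)
    qed (simp add: L0)
    then show ?thesis
      using 2 L' by (auto simp: represents_def z T act_def nth0_tl)
  next
    case 3
    have "(f(h := s)) (h + int i) = nth0 (s # tl r) i" for i
      using R' by (cases i) (auto simp: nth0_tl algebra_simps)
    then show ?thesis
      using 3 L by (auto simp: represents_def z T act_def)
  qed
qed

lemma represents_word_tape: "represents (word_tape x) ([], x)"
  by (auto simp: represents_def word_tape_def nth0_def)

lemma represents_tape_word:
  assumes "represents T (l, y @ [0])" and "0 \<notin> set y"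
  shows "tape_word T y"
proof -
  have R: "snd T (fst T + int i) = nth0 (y @ [0]) i" for i
    using assms(1) by (simp add: represents_def)
  have "y ! j \<noteq> 0" if "j < length y" for j
    using that assms(2) by (metis nth_mem)
  then show ?thesis
    by (simp add: tape_word_def R nth0_def nth_append)
qed

section \<open>While programs and their running time\<close>

datatype com =
    Act nat "nat \<Rightarrow> nat" int
  | Seq com com  (infixr \<open>;;\<close> 60)
  | Cond nat "nat \<Rightarrow> bool" com com
  | While nat "nat \<Rightarrow> bool" com

text \<open>Each action and each test takes one step, as in the compiled machine, while sequencing
  is free. The rule \<open>weaken\<close> makes the number an upper bound, so that estimates can be
  rounded up locally.\<close>

inductive exec :: "com \<Rightarrow> zipper list \<Rightarrow> nat \<Rightarrow> zipper list \<Rightarrow> bool" where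
  Act: "i < length s \<Longrightarrow> exec (Act i g d) s 1 (s[i := zact (s ! i) (g (zscan (s ! i))) d])"
| Seq: "exec c s t s' \<Longrightarrow> exec c' s' t' s'' \<Longrightarrow> exec (c ;; c') s (t + t') s''"
| CondT: "p (zscan (s ! i)) \<Longrightarrow> i < length s \<Longrightarrow> exec c s t s' \<Longrightarrow> exec (Cond i p c c') s (Suc t) s'"
| CondF: "\<not> p (zscan (s ! i)) \<Longrightarrow> i < length s \<Longrightarrow> exec c' s t s' \<Longrightarrow> exec (Cond i p c c') s (Suc t) s'"
| WhileF: "\<not> p (zscan (s ! i)) \<Longrightarrow> i < length s \<Longrightarrow> exec (While i p c) s 1 s"
| WhileT: "p (zscan (s ! i)) \<Longrightarrow> i < length s \<Longrightarrow> exec c s t s' \<Longrightarrow> exec (While i p c) s' t' s''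
    \<Longrightarrow> exec (While i p c) s (Suc (t + t')) s''"
| weaken: "exec c s t s' \<Longrightarrow> t \<le> t' \<Longrightarrow> exec c s t' s'"

section \<open>Compilation into transition tables\<close>

fun num_states :: "com \<Rightarrow> nat" where
  "num_states (Act i g d) = 1"
| "num_states (c ;; c') = num_states c + num_states c'"
| "num_states (Cond i p c c') = Suc (num_states c + num_states c')"
| "num_states (While i p c) = Suc (num_states c)"

text \<open>
  \<open>code K c q e\<close> is the transition table of \<open>c\<close> on \<open>K\<close> tapes, occupying the states
  \<open>q, \<dots>, q + num_states c - 1\<close> and leaving to the state \<open>e\<close>.
\<close>

fun code :: "nat \<Rightarrow> com \<Rightarrow> nat \<Rightarrow> nat \<Rightarrow> nat \<Rightarrow> nat list \<Rightarrow> nat \<times> nat list \<times> int list" where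
  "code K (Act i g d) q e x v = (e, v[i := g (v ! i)], (replicate K 0)[i := d])"
| "code K (c ;; c') q e x v =
     (if x < q + num_states c then code K c q (q + num_states c) x v
      else code K c' (q + num_states c) e x v)"
| "code K (Cond i p c c') q e x v =
     (if x = q then (if p (v ! i) then Suc q else Suc q + num_states c, v, replicate K 0)
      else if x < Suc q + num_states c then code K c (Suc q) e x v
      else code K c' (Suc q + num_states c) e x v)"
| "code K (While i p c) q e x v =
     (if x = q then (if p (v ! i) then Suc q else e, v, replicate K 0)
      else code K c (Suc q) q x v)"

fun wf_com :: "nat \<Rightarrow> nat \<Rightarrow> com \<Rightarrow> bool" where
  "wf_com K S (Act i g d) \<longleftrightarrow> i < K \<and> (\<forall>x<S. g x < S) \<and> d \<in> {-1, 0, 1}"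
| "wf_com K S (c ;; c') \<longleftrightarrow> wf_com K S c \<and> wf_com K S c'"
| "wf_com K S (Cond i p c c') \<longleftrightarrow> i < K \<and> wf_com K S c \<and> wf_com K S c'"
| "wf_com K S (While i p c) \<longleftrightarrow> i < K \<and> wf_com K S c"

lemma code_wf:
  assumes "wf_com K S c" "length v = K" "set v \<subseteq> {..<S}"
    and "q \<le> x" "x < q + num_states c" "q + num_states c \<le> h" "e \<le> h"
  shows "case code K c q e x v of (x', w, d) \<Rightarrow> x' \<le> h \<and> length w = K \<and> set w \<subseteq> {..<S} \<and>
           length d = K \<and> set d \<subseteq> {-1, 0, 1}"
  using assms
proof (induction c arbitrary: q e)
  case (Act i g d)
  have "v ! i < S" using Act by (metis lessThan_iff nth_mem subsetD wf_com.simps(1))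
  then have "set (v[i := g (v ! i)]) \<subseteq> {..<S}"
    using Act set_update_subset_insert[of v i "g (v ! i)"] by auto
  moreover have "set ((replicate K (0::int))[i := d]) \<subseteq> {-1, 0, 1}"
    using Act set_update_subset_insert[of "replicate K (0::int)" i d] by (auto dest!: in_set_replicate[THEN iffD1])
  ultimately show ?case using Act by simp
next
  case (Seq c1 c2)
  then show ?case using Seq.IH(1)[of q "q + num_states c1"] Seq.IH(2)[of "q + num_states c1" e] by simp
next
  case (Cond i p c1 c2)
  then show ?case
    using Cond.IH(1)[of "Suc q" e] Cond.IH(2)[of "Suc q + num_states c1" e]
    by (auto dest!: in_set_replicate[THEN iffD1])
next
  case (While i p c)
  then show ?case using While.IH[of "Suc q" q] by (auto dest!: in_set_replicate[THEN iffD1])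
qed

definition machine :: "nat \<Rightarrow> nat \<Rightarrow> com \<Rightarrow> tm" where
  "machine K S c = \<lparr>num_tapes = K, num_syms = S, halt_state = num_states c,
     delta = code K c 0 (num_states c)\<rparr>"

lemma machine_wf: "wf_com K S c \<Longrightarrow> K \<ge> 1 \<Longrightarrow> S \<ge> 1 \<Longrightarrow> wf_tm (machine K S c)"
  unfolding wf_tm_def machine_def using code_wf[where q = 0] by simp

section \<open>Simulation of programs by the compiled machine\<close>

abbreviation reps :: "tape list \<Rightarrow> zipper list \<Rightarrow> bool" where
  "reps \<equiv> list_all2 represents"

lemma reps_scanned: "reps Ts s \<Longrightarrow> map scanned Ts = map zscan s"
  by (induction rule: list_all2_induct) (auto simp: represents_scanned)

text \<open>This is the form of every test: the scanned symbols are written back, no head moves, and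
  only the state changes.\<close>

lemma step_stay:
  assumes "delta M q (map scanned Ts) = (q', map scanned Ts, replicate (num_tapes M) 0)"
    and "length Ts = num_tapes M" "q \<noteq> halt_state M"
  shows "step M (q, Ts) = (q', Ts)"
proof -
  have "act T (scanned T) 0 = T" for T
    by (simp add: act_def scanned_def)
  then show ?thesis
    using assms by (simp add: step_def) (rule nth_equalityI; simp)
qed

text \<open>The table of \<open>M\<close> has to agree with \<open>code\<close> only on the block of
  states of \<open>c\<close>, so the induction hypotheses apply to subprograms inside a larger
  machine. As \<open>exec\<close> records upper bounds, the actual number \<open>t'\<close> of steps
  may be smaller than \<open>t\<close>.\<close>

lemma exec_simulation:
  assumes "exec c s t s'"
    and "\<And>x v. q \<le> x \<Longrightarrow> x < q + num_states c \<Longrightarrow> delta M x v = code (num_tapes M) c q e x v"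
    and "q + num_states c \<le> halt_state M" "wf_com (num_tapes M) S c"
    and "reps Ts s" "length s = num_tapes M"
  shows "\<exists>t' Ts'. t' \<le> t \<and> (step M ^^ t') (q, Ts) = (e, Ts') \<and> reps Ts' s' \<and> length s' = num_tapes M"
  using assms
proof (induction arbitrary: q e Ts rule: exec.induct)
  case (Act i s g d)
  let ?K = "num_tapes M"
  let ?a = "\<lambda>j. act (Ts ! j) ((map scanned Ts)[i := g (map scanned Ts ! i)] ! j) ((replicate ?K 0)[i := d] ! j)"
  have len: "length Ts = ?K" "i < ?K" using Act by (auto dest: list_all2_lengthD)
  have sc: "map scanned Ts ! i = zscan (s ! i)"
    using Act.prems(4) Act.hyps len reps_scanned by fastforce
  have "step M (q, Ts) = (e, map ?a [0..<?K])"
    using Act.prems(1)[of q "map scanned Ts"] Act.prems(2) by (simp add: step_def)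
  moreover have "reps (map ?a [0..<?K]) (s[i := zact (s ! i) (g (zscan (s ! i))) d])"
  proof (rule list_all2_all_nthI)
    fix j assume j: "j < length (map ?a [0..<?K])"
    have rj: "represents (Ts ! j) (s ! j)" using Act.prems j len by (auto intro: list_all2_nthD)
    show "represents (map ?a [0..<?K] ! j) (s[i := zact (s ! i) (g (zscan (s ! i))) d] ! j)"
    proof (cases "j = i")
      case True
      have "map scanned Ts ! i = scanned (Ts ! i)" "d \<in> {-1, 0, 1}"
        using len Act.prems(3) by auto
      then show ?thesis using j rj len sc True Act.prems(5) by (simp add: represents_act del: insert_iff)
    next
      case False
      have "act (Ts ! j) (scanned (Ts ! j)) 0 = Ts ! j"
        by (cases "Ts ! j") (auto simp: act_def scanned_def)
      then show ?thesis using j rj len False by simp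
    qed
  qed (simp add: Act.prems(5))
  ultimately show ?case
    using Act.prems(5) by (intro exI[of _ 1] exI[of _ "map ?a [0..<?K]"]) simp
next
  case (Seq c s t s' c' t' s'')
  obtain t1 T1 where 1: "t1 \<le> t" "(step M ^^ t1) (q, Ts) = (q + num_states c, T1)" "reps T1 s'"
    "length s' = num_tapes M"
    using Seq.IH(1)[of q "q + num_states c" Ts] Seq.prems(2-5)
    by (simp add: Seq.prems(1)) blast
  obtain t2 T2 where 2: "t2 \<le> t'" "(step M ^^ t2) (q + num_states c, T1) = (e, T2)" "reps T2 s''"
    "length s'' = num_tapes M"
    using Seq.IH(2)[of "q + num_states c" e T1] Seq.prems(2-5) 1
    by (simp add: Seq.prems(1)) blast
  show ?case
    using 1 2 by (intro exI[of _ "t2 + t1"] exI[of _ T2]) (simp add: funpow_add)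
next
  case (CondT p s i c t s' c')
  have "step M (q, Ts) = (Suc q, Ts)"
    using CondT.prems(2,5) CondT.hyps reps_scanned[OF CondT.prems(4)] list_all2_lengthD[OF CondT.prems(4)]
    by (intro step_stay) (simp_all add: CondT.prems(1))
  moreover obtain t1 T1 where "t1 \<le> t" "(step M ^^ t1) (Suc q, Ts) = (e, T1)" "reps T1 s'"
    "length s' = num_tapes M"
    using CondT.IH[of "Suc q" e Ts] CondT.prems(2-5)
    by (simp add: CondT.prems(1)) blast
  ultimately show ?case
    by (intro exI[of _ "Suc t1"] exI[of _ T1]) (simp add: funpow_Suc_right del: funpow.simps)
next
  case (CondF p s i c' t s' c)
  have "step M (q, Ts) = (Suc q + num_states c, Ts)"
    using CondF.prems(2,5) CondF.hyps reps_scanned[OF CondF.prems(4)] list_all2_lengthD[OF CondF.prems(4)]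
    by (intro step_stay) (simp_all add: CondF.prems(1))
  moreover obtain t1 T1 where "t1 \<le> t" "(step M ^^ t1) (Suc q + num_states c, Ts) = (e, T1)" "reps T1 s'"
    "length s' = num_tapes M"
    using CondF.IH[of "Suc q + num_states c" e Ts] CondF.prems(2-5)
    by (simp add: CondF.prems(1)) blast
  ultimately show ?case
    by (intro exI[of _ "Suc t1"] exI[of _ T1]) (simp add: funpow_Suc_right del: funpow.simps)
next
  case (WhileF p s i c)
  have "step M (q, Ts) = (e, Ts)"
    using WhileF.prems(2,5) WhileF.hyps reps_scanned[OF WhileF.prems(4)] list_all2_lengthD[OF WhileF.prems(4)]
    by (intro step_stay) (simp_all add: WhileF.prems(1))
  then show ?case
    using WhileF.prems by (intro exI[of _ 1] exI[of _ Ts]) auto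
next
  case (WhileT p s i c t s' t' s'')
  have "step M (q, Ts) = (Suc q, Ts)"
    using WhileT.prems(2,5) WhileT.hyps reps_scanned[OF WhileT.prems(4)] list_all2_lengthD[OF WhileT.prems(4)]
    by (intro step_stay) (simp_all add: WhileT.prems(1))
  moreover obtain t1 T1 where 1: "t1 \<le> t" "(step M ^^ t1) (Suc q, Ts) = (q, T1)" "reps T1 s'"
    "length s' = num_tapes M"
    using WhileT.IH(1)[of "Suc q" q Ts] WhileT.prems(2-5)
    by (simp add: WhileT.prems(1)) blast
  moreover obtain t2 T2 where "t2 \<le> t'" "(step M ^^ t2) (q, T1) = (e, T2)" "reps T2 s''"
    "length s'' = num_tapes M"
    using WhileT.IH(2)[of q e T1] WhileT.prems(2-5) 1
    by (simp add: WhileT.prems(1)) blast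
  ultimately show ?case
    by (intro exI[of _ "Suc (t2 + t1)"] exI[of _ T2])
       (simp add: funpow_add funpow_Suc_right del: funpow.simps)
next
  case (weaken c s t s' t')
  obtain t1 T1 where "t1 \<le> t" "(step M ^^ t1) (q, Ts) = (e, T1)" "reps T1 s'"
    "length s' = num_tapes M"
    using weaken.IH[OF weaken.prems] by blast
  then show ?case using weaken.hyps by (intro exI[of _ t1] exI[of _ T1]) simp
qed

lemma list_all2_replicate: "P x y \<Longrightarrow> list_all2 P (replicate n x) (replicate n y)"
  by (induction n) auto

lemma halted_steps: "(step M ^^ t) (halt_state M, Ts) = (halt_state M, Ts)"
  by (induction t) (auto simp: step_def)

lemma machine_computes:
  assumes "exec c (([], x) # replicate (K - 1) ([], [])) t s'" "wf_com K S c" "K \<ge> 1"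
    and "last s' = (l, y @ [0])" "0 \<notin> set y" "set x \<subseteq> {1..<S}"
  shows "computes_within (machine K S c) x y t"
proof -
  let ?M = "machine K S c"
  have "reps (snd (init ?M x)) (([], x) # replicate (K - 1) ([], []))"
    using represents_word_tape[of x] represents_word_tape[of "[]"]
    by (simp add: init_def machine_def list_all2_replicate)
  then obtain t' Ts where t': "t' \<le> t" "(step ?M ^^ t') (init ?M x) = (num_states c, Ts)" "reps Ts s'"
    "length s' = K"
    using exec_simulation[OF assms(1), of 0 ?M "num_states c" S "snd (init ?M x)"] assms(2,3)
    by (auto simp: machine_def init_def)
  \<comment> \<open>A halted configuration is a fixed point, which fills up the remaining
    steps.\<close>
  have "(step ?M ^^ t) (init ?M x) = (step ?M ^^ (t - t')) ((step ?M ^^ t') (init ?M x))"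
    using t'(1) by (metis comp_apply funpow_add le_add_diff_inverse2)
  also have "\<dots> = (num_states c, Ts)"
    using t'(2) halted_steps[of "t - t'" ?M Ts] by (simp add: machine_def)
  finally have e: "(step ?M ^^ t) (init ?M x) = (num_states c, Ts)" .
  have "Ts \<noteq> []" "s' \<noteq> []"
    using t'(4) assms(3) list_all2_lengthD[OF t'(3)] by auto
  then have "represents (last Ts) (last s')"
    using t'(3,4) assms(3) list_all2_lengthD[OF t'(3)] list_all2_nthD[OF t'(3), of "K - 1"]
    by (simp add: last_conv_nth)
  then have "tape_word (last Ts) y"
    using assms(4,5) represents_tape_word by simp
  then show ?thesis
    using e assms(6) by (simp add: computes_within_def machine_def)
qed

text \<open>A step adds at most one cell to the left of a head. This later bounds the length of the
  output by the time spent writing it.\<close>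

lemma exec_length_left:
  "exec c s t s' \<Longrightarrow> length s' = length s \<and> length (fst (s' ! i)) \<le> length (fst (s ! i)) + t"
proof (induction rule: exec.induct)
  case (Act j s g d)
  then show ?case by (cases "s ! j"; cases "i = j") (auto simp: nth_list_update)
qed auto

section \<open>Four tapes\<close>

text \<open>
  Tape 0 holds the input, tape 1 a unary counter, tape 2 a register for the current coefficient
  in a single cell, and tape 3 the output.
\<close>

abbreviation mv :: "nat \<Rightarrow> int \<Rightarrow> com" where "mv i d \<equiv> Act i (\<lambda>x. x) d"
abbreviation emit :: "nat \<Rightarrow> com" where "emit a \<equiv> Act 3 (\<lambda>_. a) 1"
abbreviation set_reg :: "nat \<Rightarrow> com" where "set_reg a \<equiv> Act 2 (\<lambda>_. a) 0"
abbreviation toggle_reg :: com where "toggle_reg \<equiv> Act 2 (\<lambda>x. 3 - x) 0"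
abbreviation skip :: com where "skip \<equiv> mv 2 0"

lemma exec_ActI:
  "i < length s \<Longrightarrow> s' = s[i := zact (s ! i) (g (zscan (s ! i))) d] \<Longrightarrow> exec (Act i g d) s 1 s'"
  using exec.Act by blast

lemma exec_WhileI:
  "exec c s t s1 \<Longrightarrow> exec (While i p c) s1 t' s2 \<Longrightarrow> s0 = s \<Longrightarrow> s2 = s3 \<Longrightarrow> p (zscan (s ! i))
    \<Longrightarrow> i < length s \<Longrightarrow> Suc (t + t') \<le> t'' \<Longrightarrow> exec (While i p c) s0 t'' s3"
  by (rule exec.weaken[OF exec.WhileT]) simp_all

section \<open>Basic moves, sweeps and rewinding\<close>

lemma exec_basic:
  "exec (mv 0 1) [(l, x # r), u, f, w] 1 [(x # l, r), u, f, w]"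
  "exec (mv 1 1) [a, (l, x # r), f, w] 1 [a, (x # l, r), f, w]"
  "exec (emit b) [a, u, f, (l, [])] 1 [a, u, f, (b # l, [])]"
  "exec (set_reg b) [a, u, ([], [c]), w] 1 [a, u, ([], [b]), w]"
  "exec (toggle_reg) [a, u, ([], [c]), w] 1 [a, u, ([], [3 - c]), w]"
  "exec skip [a, u, ([], [c]), w] 1 [a, u, ([], [c]), w]"
  by (rule exec_ActI; simp add: numeral_2_eq_2 numeral_3_eq_3)+

lemma exec_mark_left:
  "l \<noteq> [] \<Longrightarrow> exec (mv 1 (-1)) [a, (l, x # r), f, w] 1 [a, (tl l, hd l # x # r), f, w]"
  "l \<noteq> [] \<Longrightarrow> exec (Act 1 (\<lambda>_. b) (-1)) [a, (l, x # r), f, w] 1 [a, (tl l, hd l # b # r), f, w]"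
  by (rule exec_ActI; cases l; simp)+

text \<open>The blank to the left of \<open>x\<close> is the end marker: the loop walks left until
  it reads this blank, and the last move goes back to the first symbol. Leaving the scanned cell
  makes it explicit even if it was blank, hence \<open>nth0 r 0 # tl r\<close>.\<close>

lemma exec_rewind:
  assumes "i < length s" "s ! i = (rev x @ [0], r)" "0 \<notin> set x"
  shows "exec (mv i (-1) ;; While i (\<lambda>a. a \<noteq> 0) (mv i (-1)) ;; mv i 1) s (2 * length x + 3)
           (s[i := ([0], x @ nth0 r 0 # tl r)])"
proof -
  \<comment> \<open>The head stands on the last symbol of \<open>x\<close>, or on the marker if
    \<open>x\<close> is empty; \<open>hd\<close> and \<open>tl\<close> cover both cases.\<close>
  have loop: "exec (While i (\<lambda>a. a \<noteq> 0) (mv i (-1))) (s[i := (tl (rev x @ [0]), hd (rev x @ [0]) # r)])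
      (2 * length x + 1) (s[i := ([], 0 # x @ r)])" if "0 \<notin> set x" for x r
    using that
  proof (induction x arbitrary: r rule: rev_induct)
    case Nil
    then show ?case using exec.WhileF[of "\<lambda>a. a \<noteq> 0"] assms(1) by simp
  next
    case (snoc a x)
    let ?s = "s[i := (rev x @ [0], a # r)]"
    have "exec (mv i (-1)) ?s 1 (s[i := (tl (rev x @ [0]), hd (rev x @ [0]) # a # r)])"
      by (rule exec_ActI) (use assms(1) in \<open>auto simp: nth0_def hd_conv_nth\<close>)
    from exec.WhileT[of "\<lambda>a. a \<noteq> 0", OF _ _ this snoc.IH] show ?case
      using snoc.prems assms(1) by (auto elim!: exec.weaken)
  qed
  have "exec (mv i (-1)) s 1 (s[i := (tl (rev x @ [0]), hd (rev x @ [0]) # nth0 r 0 # tl r)])"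
    by (rule exec_ActI) (use assms in \<open>auto simp: nth0_def hd_conv_nth\<close>)
  moreover have "exec (mv i 1) (s[i := ([], 0 # x @ nth0 r 0 # tl r)]) 1 (s[i := ([0], x @ nth0 r 0 # tl r)])"
    by (rule exec_ActI) (use assms in auto)
  ultimately show ?thesis
    using exec.weaken[OF exec.Seq[OF _ exec.Seq[OF loop[OF assms(3)]]]] by simp
qed

abbreviation rewind :: "nat \<Rightarrow> com" where
  "rewind i \<equiv> mv i (-1) ;; While i (\<lambda>a. a \<noteq> 0) (mv i (-1)) ;; mv i 1"

lemma exec_right:
  assumes "i < length s" "s ! i = (l, x @ r)" "\<forall>a\<in>set x. p a" "\<not> p (nth0 r 0)"
  shows "exec (While i p (mv i 1)) s (2 * length x + 1) (s[i := (rev x @ l, r)])"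
  using assms
proof (induction x arbitrary: s l)
  case Nil
  then show ?case using exec.WhileF[of p s i] by (simp add: list_update_same_conv[THEN iffD2])
next
  case (Cons a x)
  let ?s = "s[i := (a # l, x @ r)]"
  have "exec (mv i 1) s 1 ?s"
    by (rule exec_ActI) (use Cons.prems in auto)
  moreover have "exec (While i p (mv i 1)) ?s (2 * length x + 1) (?s[i := (rev x @ a # l, r)])"
    by (rule Cons.IH) (use Cons.prems in auto)
  ultimately have "exec (While i p (mv i 1)) s (Suc (1 + (2 * length x + 1))) (?s[i := (rev x @ a # l, r)])"
    using Cons.prems by (intro exec.WhileT) auto
  then show ?case by (rule exec.weaken[THEN rev_mp]) auto
qed

text \<open>Each cell carrying \<open>a\<close> makes \<open>w\<close> write \<open>W\<close> once,
  and the symbol \<open>y\<close> ends the walk. With \<open>hd\<close> and \<open>tl\<close> of the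
  left part the head is placed correctly also for \<open>k = 0\<close>, where it already stands on
  \<open>y\<close>.\<close>

lemma exec_left_sweep:
  assumes w: "\<And>i u f b. exec w [i, u, f, (b, [])] t [i, u, f, (rev W @ b, [])]" and "y \<noteq> a"
  shows "exec (While 1 (\<lambda>x. x = a) (w ;; mv 1 (-1)))
     [i, (tl (replicate k a @ y # l), hd (replicate k a @ y # l) # r), f, (b, [])] (k * (t + 2) + 1)
     [i, (l, y # replicate k a @ r), f, (rev (concat (replicate k W)) @ b, [])]"
proof (induction k arbitrary: r b)
  case 0
  then show ?case using exec.WhileF[of "\<lambda>x. x = a" _ 1] assms(2) by simp
next
  case (Suc k)
  let ?l = "replicate k a @ y # l"
  have "exec (w ;; mv 1 (-1)) [i, (?l, a # r), f, (b, [])] (t + 1)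
     [i, (tl ?l, hd ?l # a # r), f, (rev W @ b, [])]"
    by (rule exec.Seq[OF w exec_mark_left(1)]) simp
  then show ?case
    by (rule exec_WhileI[OF _ Suc.IH]) (auto simp: replicate_app_Cons_same)
qed

text \<open>
  Content of tape 1 after \<open>k\<close> monomials have been written. Sweeping over it to the right pads the
  exponents of the variables, sweeping back writes and advances the serial number.
\<close>

definition thermo :: "nat \<Rightarrow> nat \<Rightarrow> nat list" where
  "thermo L k = replicate (L - k) 1 @ replicate k 2"

text \<open>This completes a monomial. Going right, the code \<open>3\<close> of exponent 0 is
  written for each ordinary variable that is left. Going back, a \<open>2\<close> yields the code of
  exponent 2 and a \<open>1\<close> that of exponent 0, and the first \<open>1\<close> met is turned
  into \<open>2\<close>, which advances the serial number. The final \<open>5\<close> closes the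
  exponent vector.\<close>

definition pad_mark :: com where
  "pad_mark = While 1 (\<lambda>x. x \<noteq> 0) (emit 3 ;; mv 1 1) ;; mv 1 (-1) ;;
     While 1 (\<lambda>x. x = 2) ((emit 1 ;; emit 2 ;; emit 3) ;; mv 1 (-1)) ;;
     Act 1 (\<lambda>_. 2) (-1) ;; emit 3 ;;
     While 1 (\<lambda>x. x = 1) (emit 3 ;; mv 1 (-1)) ;; mv 1 1 ;; emit 5"

lemma exec_pad:
  assumes "0 \<notin> set x"
  shows "exec (While 1 (\<lambda>x. x \<noteq> 0) (emit 3 ;; mv 1 1)) [i, (l, x @ [0]), f, (b, [])] (3 * length x + 1)
     [i, (rev x @ l, [0]), f, (replicate (length x) 3 @ b, [])]"
  using assms
proof (induction x arbitrary: l b)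
  case Nil
  then show ?case using exec.WhileF[of "\<lambda>x. x \<noteq> 0" _ 1] by simp
next
  case (Cons a x)
  have "exec (emit 3 ;; mv 1 1) [i, (l, a # x @ [0]), f, (b, [])] (1 + 1)
     [i, (a # l, x @ [0]), f, (3 # b, [])]"
    by (rule exec.Seq exec_basic)+
  then show ?case
    by (rule exec_WhileI[OF _ Cons.IH]) (use Cons.prems in \<open>auto simp: replicate_app_Cons_same\<close>)
qed

lemma exec_emit3:
  "exec (emit a) [i, u, f, (b, [])] 1 [i, u, f, (rev [a] @ b, [])]"
  "exec (emit a ;; emit a' ;; emit a'') [i, u, f, (b, [])] (1 + (1 + 1)) [i, u, f, (rev [a, a', a''] @ b, [])]"
  unfolding rev.simps append.simps by (rule exec.Seq exec_basic)+

text \<open>\<open>x1\<close> is the part of the counter passed while exponents were copied, so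
  \<open>x2\<close> has one cell per missing exponent. The condition \<open>k < L\<close> provides
  the \<open>1\<close> that gets marked.\<close>

lemma exec_pad_mark:
  assumes "x1 @ x2 = thermo L k" "k < L"
  shows "exec pad_mark [i, (rev x1 @ [0], x2 @ [0]), f, (b, [])] (8 * L + 10)
     [i, ([0], thermo L (Suc k) @ [0]), f,
      (rev (replicate (length x2) 3 @ concat (replicate k [1, 2, 3]) @ replicate (L - k) 3 @ [5]) @ b, [])]"
proof -
  \<comment> \<open>\<open>m\<close> is the number of cells that are still \<open>1\<close> after
    marking.\<close>
  obtain m where m: "L = Suc (k + m)" using assms(2) less_iff_Suc_add by auto
  have th: "x1 @ x2 = replicate (Suc m) 1 @ replicate k 2"
    using assms(1) m by (simp add: thermo_def)
  have "0 \<notin> set (x1 @ x2)" unfolding th by auto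
  then have x2: "0 \<notin> set x2" by simp
  have "length (x1 @ x2) = L" unfolding th using m by simp
  then have len: "length x2 \<le> L" by simp
  \<comment> \<open>On the way back the sweep meets the \<open>k\<close> marked cells first.\<close>
  have "rev x2 @ rev x1 = rev (x1 @ x2)" by simp
  also have "\<dots> = replicate k 2 @ replicate (Suc m) 1"
    unfolding th by (simp add: replicate_append_same)
  finally have rv: "rev x2 @ rev x1 @ [0] = replicate k 2 @ 1 # replicate m 1 @ [0]" by (metis append_Cons append_assoc replicate_Suc)
  have ne: "(1::nat) \<noteq> 2" "(0::nat) \<noteq> 1" by auto
  let ?b1 = "replicate (length x2) 3 @ b"
  let ?b2 = "rev (concat (replicate k [1, 2, 3])) @ ?b1"
  let ?l = "replicate k 2 @ 1 # replicate m 1 @ [0]"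
  let ?l' = "replicate m 1 @ 0 # []"
  note 1 = exec_pad[OF x2, of i "rev x1 @ [0]" f b, unfolded rv]
  have 2: "exec (mv 1 (-1)) [i, (?l, [0]), f, (?b1, [])] 1 [i, (tl ?l, hd ?l # [0]), f, (?b1, [])]"
    using exec_mark_left(1)[of ?l] by simp
  note 3 = exec_left_sweep[OF exec_emit3(2) ne(1), of 1 2 3 i k "replicate m 1 @ [0]" "[0]" f ?b1]
  have 4: "exec (Act 1 (\<lambda>_. 2) (-1)) [i, (?l', 1 # replicate k 2 @ [0]), f, (?b2, [])] 1
     [i, (tl ?l', hd ?l' # 2 # replicate k 2 @ [0]), f, (?b2, [])]"
    using exec_mark_left(2)[of ?l'] by simp
  note 5 = exec_left_sweep[OF exec_emit3(1) ne(2), of 3 i m "[]" "2 # replicate k 2 @ [0]" f "3 # ?b2"]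
  have "exec pad_mark [i, (rev x1 @ [0], x2 @ [0]), f, (b, [])]
     ((3 * length x2 + 1) + (1 + ((k * (1 + (1 + 1) + 2) + 1) + (1 + (1 + ((m * (1 + 2) + 1) + (1 + 1)))))))
     [i, ([0], replicate m 1 @ 2 # replicate k 2 @ [0]), f, (5 # rev (concat (replicate m [3])) @ 3 # ?b2, [])]"
    unfolding pad_mark_def
    by (rule exec.Seq 1 2 3 4 5 exec_basic)+
  then have "exec pad_mark [i, (rev x1 @ [0], x2 @ [0]), f, (b, [])] (8 * L + 10)
     [i, ([0], replicate m 1 @ 2 # replicate k 2 @ [0]), f, (5 # rev (concat (replicate m [3])) @ 3 # ?b2, [])]"
    by (rule exec.weaken) (use len m in simp)
  moreover have "concat (replicate m [3]) = replicate m (3::nat)" by (induction m) auto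
  ultimately show ?thesis
    by (simp add: thermo_def m replicate_app_Cons_same)
qed

section \<open>Writing the monomials of a gate\<close>

lemma bits_0 [simp]: "bits 0 = []"
  by (simp add: bits.simps)

lemma bits_double: "n > 0 \<Longrightarrow> bits (2 * n) = 1 # bits n"
  by (subst bits.simps) simp

lemma bits_double_Suc: "bits (Suc (2 * n)) = 2 # bits n"
  by (subst bits.simps) simp

lemma set_bits: "set (bits n) \<subseteq> {1, 2}"
proof (induction n rule: bits.induct)
  case (1 n)
  then show ?case by (subst bits.simps) auto
qed

lemma enc_nat_small [simp]: "enc_nat 0 = [3]" "enc_nat (Suc 0) = [2, 3]" "enc_nat 2 = [1, 2, 3]"
  using bits_double[of 1] bits_double_Suc[of 0] by (simp_all add: enc_nat_def)

lemma set_enc_nat: "set (enc_nat n) \<subseteq> {1, 2, 3}"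
  using set_bits[of n] by (auto simp: enc_nat_def)

text \<open>The least significant digit comes first, so one symbol decides the parity; zero has no
  digits and starts with the end mark \<open>3\<close>. As no code starts with \<open>5\<close>,
  loops over lists recognise the closing bracket.\<close>

lemma enc_nat_scan: "nth0 (enc_nat n @ x) 0 = 2 \<longleftrightarrow> odd n" "nth0 (enc_nat n @ x) 0 \<noteq> 5"
proof -
  consider "n = 0" | m where "m > 0" "n = 2 * m" | m where "n = Suc (2 * m)"
    by (cases "even n"; cases "n = 0") (auto elim!: evenE oddE)
  then have "(nth0 (enc_nat n @ x) 0 = 2 \<longleftrightarrow> odd n) \<and> nth0 (enc_nat n @ x) 0 \<noteq> 5"
    by cases (auto simp: enc_nat_def bits_double bits_double_Suc)
  then show "nth0 (enc_nat n @ x) 0 = 2 \<longleftrightarrow> odd n" "nth0 (enc_nat n @ x) 0 \<noteq> 5" by auto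
qed

lemma length_enc_nat: "length (enc_nat n) = Suc (length (bits n))"
  by (simp add: enc_nat_def)

lemma exec_eqI: "exec c s t s1 \<Longrightarrow> t \<le> t' \<Longrightarrow> s1 = s2 \<Longrightarrow> exec c s t' s2"
  by (simp add: exec.weaken)

lemma exec_CondI:
  "i < length s \<Longrightarrow> (p (zscan (s ! i)) \<Longrightarrow> exec c s t s') \<Longrightarrow> (\<not> p (zscan (s ! i)) \<Longrightarrow> exec c' s t s')
    \<Longrightarrow> exec (Cond i p c c') s (Suc t) s'"
  by (cases "p (zscan (s ! i))") (simp_all add: exec.CondT exec.CondF)

abbreviation "encs v \<equiv> concat (map enc_nat v)"

text \<open>
  A raw monomial is a coefficient with the exponents of the leading variables. As the exponents
  0 and 2 are interchangeable at \<open>\<plusminus>1\<close>, the last \<open>L\<close> exponents can hold a serial number that makes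
  all monomials distinct.
\<close>

definition serial_mono :: "nat \<Rightarrow> nat \<Rightarrow> nat \<times> nat list \<Rightarrow> nat \<times> nat list" where
  "serial_mono L k m = (fst m, snd m @ replicate (L - length (snd m)) 0 @ replicate k 2 @ replicate (L - k) 0)"

definition numbered :: "nat \<Rightarrow> nat \<Rightarrow> (nat \<times> nat list) list \<Rightarrow> expanded_poly" where
  "numbered L k ms = map (\<lambda>(i, m). serial_mono L i m) (List.enumerate k ms)"

definition emitted :: "nat \<Rightarrow> nat \<Rightarrow> (nat \<times> nat list) list \<Rightarrow> nat list" where
  "emitted L k ms = concat (map enc_monomial (numbered L k ms))"

lemma emitted_Nil [simp]: "emitted L k [] = []"
  by (simp add: emitted_def numbered_def)

lemma emitted_Cons: "emitted L k (m # ms) = enc_monomial (serial_mono L k m) @ emitted L (Suc k) ms"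
  by (simp add: emitted_def numbered_def)

lemma emitted_append: "emitted L k (ms @ ms') = emitted L k ms @ emitted L (k + length ms) ms'"
  by (induction ms arbitrary: k) (auto simp: emitted_Cons)

lemma enc_mono:
  "enc_monomial (serial_mono L k (c, v)) = enc_nat c @ [4] @ encs v @ replicate (L - length v) 3 @
     concat (replicate k [1, 2, 3]) @ replicate (L - k) 3 @ [5]"
proof -
  have "encs (replicate m 0) = replicate m 3" for m by (induction m) auto
  then show ?thesis by (simp add: enc_monomial_def serial_mono_def enc_list_def)
qed

text \<open>The state between two monomials: \<open>k\<close> monomials are finished, the register
  holds \<open>f\<close>, the reversed output so far is \<open>b\<close>, and the counter head is at
  the left end of the counter, after a blank marker.\<close>

abbreviation st where
  "st L l x f k b \<equiv> [(l, x), ([0], thermo L k @ [0]), ([], [f]), (b, [])]"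

section \<open>Monomials of gates at depth 1\<close>

definition emit_coeff :: com where
  "emit_coeff = Cond 2 (\<lambda>x. x = 1) (emit 2 ;; emit 3) (emit 1 ;; emit 2 ;; emit 3)"

definition emit_const :: com where
  "emit_const = emit_coeff ;; emit 4 ;; pad_mark"

lemma exec_emit_coeff:
  assumes "c \<in> {1, 2}"
  shows "exec emit_coeff [i, u, ([], [c]), (b, [])] 4 [i, u, ([], [c]), (rev (enc_nat c) @ b, [])]"
proof (cases "c = 1")
  case True
  have "exec (emit 2 ;; emit 3) [i, u, ([], [c]), (b, [])] (1 + 1) [i, u, ([], [c]), (3 # 2 # b, [])]"
    by (rule exec.Seq exec_basic)+
  note 1 = exec.CondT[of "\<lambda>x. x = 1" _ 2, OF _ _ this]
  show ?thesis
    unfolding emit_coeff_def by (rule exec_eqI[OF 1]) (simp_all add: True numeral_2_eq_2)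
next
  case False
  then have c: "c = 2" using assms by simp
  have "exec (emit 1 ;; emit 2 ;; emit 3) [i, u, ([], [c]), (b, [])] (1 + (1 + 1)) [i, u, ([], [c]), (3 # 2 # 1 # b, [])]"
    by (rule exec.Seq exec_basic)+
  note 1 = exec.CondF[of "\<lambda>x. x = 1" _ 2, OF _ _ this]
  show ?thesis
    unfolding emit_coeff_def by (rule exec_eqI[OF 1]) (simp_all add: c)
qed

lemma exec_emit_const:
  assumes "c \<in> {1, 2}" "k < L"
  shows "exec emit_const (st L l x c k b) (8 * L + 15)
     (st L l x c (Suc k) (rev (enc_monomial (serial_mono L k (c, []))) @ b))"
proof -
  have "exec pad_mark [(l, x), ([0], thermo L k @ [0]), ([], [c]), (4 # rev (enc_nat c) @ b, [])] (8 * L + 10)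
     (st L l x c (Suc k) (rev (enc_monomial (serial_mono L k (c, []))) @ b))"
    using exec_pad_mark[of "[]" "thermo L k" L k "(l, x)" "([], [c])" "4 # rev (enc_nat c) @ b"] assms(2)
    by (simp add: enc_mono thermo_def)
  note 1 = exec.Seq[OF exec_emit_coeff[OF assms(1)] exec.Seq[OF exec_basic(3) this]]
  show ?thesis
    unfolding emit_const_def by (rule exec_eqI[OF 1]) simp_all
qed

definition skip_num :: com where
  "skip_num = While 0 (\<lambda>x. x \<noteq> 3) (mv 0 1) ;; mv 0 1"

lemma exec_skip_num:
  "exec skip_num [(l, enc_nat n @ x), u, f, w] (2 * length (enc_nat n)) [(rev (enc_nat n) @ l, x), u, f, w]"
proof -
  have "\<forall>a\<in>set (bits n). a \<noteq> 3" using set_bits[of n] by auto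
  then have "exec (While 0 (\<lambda>x. x \<noteq> 3) (mv 0 1)) [(l, bits n @ 3 # x), u, f, w] (2 * length (bits n) + 1)
     [(rev (bits n) @ l, 3 # x), u, f, w]"
    using exec_right[of 0 "[(l, bits n @ 3 # x), u, f, w]" l "bits n" "3 # x" "\<lambda>a. a \<noteq> 3"] by simp
  from exec.Seq[OF this exec_basic(1)] show ?thesis
    unfolding skip_num_def by (simp add: enc_nat_def)
qed

text \<open>At \<open>\<plusminus>1\<close> only the parity of a multiplicity matters, and the first
  digit shows it. The move on tape 1 counts the variables that have received an exponent.\<close>

definition exponent :: com where
  "exponent = Cond 0 (\<lambda>x. x = 2) (emit 2) skip ;; skip_num ;; emit 3 ;; mv 1 1"

lemma exec_exponent:
  "exec exponent [(l, enc_nat e @ x), (ul, u # ur), ([], [c]), (b, [])] (2 * length (enc_nat e) + 4)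
     [(rev (enc_nat e) @ l, x), (u # ul, ur), ([], [c]), (rev (enc_nat (e mod 2)) @ b, [])]"
proof -
  let ?b = "(if odd e then [2] else []) @ b"
  have "exec (Cond 0 (\<lambda>x. x = 2) (emit 2) skip) [(l, enc_nat e @ x), (ul, u # ur), ([], [c]), (b, [])] (Suc 1)
     [(l, enc_nat e @ x), (ul, u # ur), ([], [c]), (?b, [])]"
    by (rule exec_CondI) (simp_all add: enc_nat_scan exec_basic[unfolded One_nat_def])
  note 1 = this exec_skip_num exec_basic(2,3)
  show ?thesis
    unfolding exponent_def
    by (rule exec_eqI, (rule exec.Seq 1)+) (auto simp: odd_iff_mod_2_eq_one)
qed

lemma exec_exponents:
  assumes "length u1 = length es"
  shows "exec (While 0 (\<lambda>x. x \<noteq> 5) exponent) [(l, encs es @ 5 # x), (ul, u1 @ u2), ([], [c]), (b, [])]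
     (7 * length (encs es) + 1)
     [(rev (encs es) @ l, 5 # x), (rev u1 @ ul, u2), ([], [c]), (rev (encs (map (\<lambda>e. e mod 2) es)) @ b, [])]"
  using assms
proof (induction es arbitrary: u1 l ul b)
  case Nil
  then show ?case using exec.WhileF[of "\<lambda>x. x \<noteq> 5" _ 0] by simp
next
  case (Cons e es)
  then obtain u u' where u: "u1 = u # u'" by (cases u1) auto
  show ?case
    by (rule exec_WhileI[OF exec_exponent[of l e "encs es @ 5 # x" ul u "u' @ u2"] Cons.IH[of u']])
       (use Cons.prems u in \<open>auto simp: enc_nat_scan length_enc_nat\<close>)
qed

text \<open>The multiplier \<open>f\<close> of the gate value is 1 in the first pass and 2 in the
  second. Toggling the register multiplies the coefficient by 2, equivalently by -1, modulo
  3.\<close>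

definition gate1_com :: "nat \<Rightarrow> com" where
  "gate1_com f = toggle_reg ;; emit_const ;; Cond 0 (\<lambda>x. x = 2) toggle_reg skip ;; skip_num ;; mv 0 1 ;;
     emit_coeff ;; emit 4 ;; While 0 (\<lambda>x. x \<noteq> 5) exponent ;; mv 0 1 ;; pad_mark ;; set_reg f"

text \<open>These are the two terms of f * (2 + 2 * (-1)^c * product): modulo 3 the coefficient 2 *
  f is \<open>3 - f\<close>, and an odd \<open>c\<close> changes its sign to
  \<open>f\<close>.\<close>

fun raw1 :: "nat \<Rightarrow> gate1 \<Rightarrow> (nat \<times> nat list) list" where
  "raw1 f (Gate1 c es) = [(3 - f, []), (if odd c then f else 3 - f, map (\<lambda>e. e mod 2) es)]"

text \<open>Codes have positive length \<open>n\<close>, so a fixed cost can be absorbed into the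
  cost per symbol.\<close>

lemma time_bound:
  fixes n :: nat
  assumes "n > 0" "b + d \<le> c"
  shows "a + b + d * n \<le> (a + c) * n"
proof -
  obtain m where n: "n = Suc m" using assms(1) by (cases n) auto
  have "d * m \<le> c * m" using assms(2) by (intro mult_right_mono) auto
  moreover have "(a + c) * Suc m = a + c + (a * m + c * m)" "d * Suc m = d + d * m"
    by (simp_all add: algebra_simps)
  ultimately show ?thesis using assms(2) unfolding n by linarith
qed

lemma exec_gate1:
  assumes "f \<in> {1, 2}" "Suc k < L" "g = Gate1 c es" "length es \<le> L"
  shows "exec (gate1_com f) (st L l (enc_gate1 g @ x) f k b) ((16 * L + 60) * length (enc_gate1 g))
     (st L (rev (enc_gate1 g) @ l) x f (k + 2) (rev (emitted L k (raw1 f g)) @ b))"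
proof -
  \<comment> \<open>The exponent loop passes \<open>u1\<close>, one counter cell per variable, and
    \<open>pad_mark\<close> starts at \<open>u2\<close>.\<close>
  define u1 where "u1 = take (length es) (thermo L (Suc k))"
  define u2 where "u2 = drop (length es) (thermo L (Suc k))"
  have lt: "length (thermo L (Suc k)) = L" using assms(2) by (simp add: thermo_def)
  have u: "thermo L (Suc k) @ [0] = u1 @ (u2 @ [0])" "u1 @ u2 = thermo L (Suc k)"
    "length u1 = length es" "length u2 = L - length es"
    using assms(4) lt by (auto simp: u1_def u2_def)
  let ?c = "if odd c then f else 3 - f"
  let ?i = "(l, enc_nat c @ 4 # encs es @ 5 # x)"
  have f: "3 - f \<in> {1, 2}" "?c \<in> {1, 2}" "3 - (3 - f) = f" using assms(1) by auto
  let ?b1 = "rev (enc_monomial (serial_mono L k (3 - f, []))) @ b"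
  have 1: "exec emit_const (st L l (snd ?i) (3 - f) k b) (8 * L + 15) [?i, ([0], u1 @ (u2 @ [0])), ([], [3 - f]), (?b1, [])]"
    unfolding u(1)[symmetric] using exec_emit_const[OF f(1), of k L] assms(2) by simp
  have 2: "exec (Cond 0 (\<lambda>x. x = 2) toggle_reg skip) [?i, v, ([], [3 - f]), w] (Suc 1) [?i, v, ([], [?c]), w]" for v w
    by (rule exec_CondI)
       (use f(3) exec_basic(5)[of ?i v "3 - f" w] in \<open>simp_all add: enc_nat_scan exec_basic(6)[unfolded One_nat_def]\<close>)
  note 3 = exec_basic(5) 1[unfolded snd_conv] 2 exec_skip_num exec_basic(1,3,4) exec_emit_coeff[OF f(2)]
    exec_exponents[OF u(3)] exec_pad_mark[OF u(2) assms(2)]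
  let ?t = "16 * L + 45 + 7 * length (enc_gate1 g)"
  have "exec (gate1_com f) (st L l (enc_nat c @ 4 # encs es @ 5 # x) f k b) ?t
     (st L (rev (enc_gate1 g) @ l) x f (k + 2) (rev (emitted L k (raw1 f g)) @ b))"
    unfolding gate1_com_def
    by (rule exec_eqI, (rule exec.Seq 3)+)
       (use u(4) in \<open>auto simp: assms(3) emitted_Cons enc_mono enc_list_def\<close>)
  moreover have "?t \<le> (16 * L + 60) * length (enc_gate1 g)"
    by (rule time_bound) (auto simp: assms(3) enc_nat_def)
  moreover have "enc_gate1 g @ x = enc_nat c @ 4 # encs es @ 5 # x"
    by (simp add: assms(3) enc_list_def)
  ultimately show ?thesis using exec.weaken by simp
qed

text \<open>The bound \<open>n \<le> L\<close> is asked for only if some gate lists the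
  \<open>n\<close> multiplicities; otherwise \<open>n\<close>, being written in binary, may be
  exponential in the length of the input.\<close>

lemma exec_gates1:
  assumes "f \<in> {1, 2}" "k + length (concat (map (raw1 f) gs)) \<le> L" "\<forall>g\<in>set gs. wf_gate1 n g" "gs \<noteq> [] \<Longrightarrow> n \<le> L"
  shows "exec (While 0 (\<lambda>x. x \<noteq> 5) (gate1_com f)) (st L l (concat (map enc_gate1 gs) @ 5 # x) f k b)
     ((16 * L + 61) * length (concat (map enc_gate1 gs)) + 1)
     (st L (rev (concat (map enc_gate1 gs)) @ l) (5 # x) f (k + length (concat (map (raw1 f) gs)))
       (rev (emitted L k (concat (map (raw1 f) gs))) @ b))"
  using assms
proof (induction gs arbitrary: k l b)
  case Nil
  then show ?case using exec.WhileF[of "\<lambda>x. x \<noteq> 5" _ 0] by simp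
next
  case (Cons g gs)
  obtain c es where g: "g = Gate1 c es" by (cases g)
  have L: "Suc k < L" "length es \<le> L" using Cons.prems g by auto
  have IH: "exec (While 0 (\<lambda>x. x \<noteq> 5) (gate1_com f)) (st L l (concat (map enc_gate1 gs) @ 5 # x) f (k + 2) b)
     ((16 * L + 61) * length (concat (map enc_gate1 gs)) + 1)
     (st L (rev (concat (map enc_gate1 gs)) @ l) (5 # x) f (k + 2 + length (concat (map (raw1 f) gs)))
       (rev (emitted L (k + 2) (concat (map (raw1 f) gs))) @ b))" for l b
    by (rule Cons.IH) (use Cons.prems g in auto)
  have pos: "length (enc_gate1 g) > 0" by (simp add: g enc_nat_def)
  have raw: "length (raw1 f g) = 2" by (simp add: g)
  have scan: "nth0 (enc_gate1 g @ y) 0 \<noteq> 5" for y by (simp add: g enc_nat_scan)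
  show ?case
    by (rule exec_WhileI[OF exec_gate1[OF assms(1) L(1) g L(2)] IH])
       (use raw pos scan in \<open>auto simp: emitted_append algebra_simps Suc_le_eq\<close>)
qed

section \<open>Gates at depth 2\<close>

fun bit_raw :: "nat \<Rightarrow> nat list \<Rightarrow> (nat \<times> nat list) list" where
  "bit_raw f [] = []"
| "bit_raw f (d # ds) = (if d = 2 then [(f, [])] else []) @ bit_raw (3 - f) ds"

text \<open>The powers of 2 alternate between 1 and -1 modulo 3, so toggling after each digit gives
  the coefficient of the next one. A constant written in binary thus costs at most one monomial per
  digit.\<close>

definition bit_com :: com where
  "bit_com = Cond 0 (\<lambda>x. x = 2) emit_const skip ;; toggle_reg ;; mv 0 1"

lemma exec_bits:
  assumes "f \<in> {1, 2}" "k + length (bit_raw f ds) \<le> L" "set ds \<subseteq> {1, 2}"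
  shows "exec (While 0 (\<lambda>x. x \<noteq> 3) bit_com) (st L l (ds @ 3 # x) f k b)
     ((8 * L + 19) * length ds + 1)
     (st L (rev ds @ l) (3 # x) (((\<lambda>x. 3 - x) ^^ length ds) f) (k + length (bit_raw f ds))
       (rev (emitted L k (bit_raw f ds)) @ b))"
  using assms
proof (induction ds arbitrary: f k l b)
  case Nil
  then show ?case using exec.WhileF[of "\<lambda>x. x \<noteq> 3" _ 0] by simp
next
  case (Cons d ds)
  let ?r = "if d = 2 then [(f, [] :: nat list)] else []"
  let ?s = "st L l (d # ds @ 3 # x) f (k + length ?r) (rev (emitted L k ?r) @ b)"
  have c: "exec (Cond 0 (\<lambda>x. x = 2) emit_const skip) (st L l (d # ds @ 3 # x) f k b) (Suc (8 * L + 15)) ?s"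
  proof (rule exec_CondI)
    assume "zscan (st L l (d # ds @ 3 # x) f k b ! 0) = 2"
    then show "exec emit_const (st L l (d # ds @ 3 # x) f k b) (8 * L + 15) ?s"
      using exec_emit_const[OF Cons.prems(1)] Cons.prems(2) by (simp add: emitted_Cons)
  next
    assume "zscan (st L l (d # ds @ 3 # x) f k b ! 0) \<noteq> 2"
    then show "exec skip (st L l (d # ds @ 3 # x) f k b) (8 * L + 15) ?s"
      using exec_eqI[OF exec_basic(6)] by simp
  qed simp
  have 1: "exec bit_com (st L l (d # ds @ 3 # x) f k b) (Suc (8 * L + 15) + (1 + 1))
     (st L (d # l) (ds @ 3 # x) (3 - f) (k + length ?r) (rev (emitted L k ?r) @ b))"
    unfolding bit_com_def by (rule exec.Seq[OF c exec.Seq[OF exec_basic(5) exec_basic(1)]])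
  have IH: "exec (While 0 (\<lambda>x. x \<noteq> 3) bit_com)
     (st L (d # l) (ds @ 3 # x) (3 - f) (k + length ?r) (rev (emitted L k ?r) @ b))
     ((8 * L + 19) * length ds + 1)
     (st L (rev ds @ d # l) (3 # x) (((\<lambda>x. 3 - x) ^^ length ds) (3 - f)) (k + length ?r + length (bit_raw (3 - f) ds))
       (rev (emitted L (k + length ?r) (bit_raw (3 - f) ds)) @ rev (emitted L k ?r) @ b))"
    by (rule Cons.IH) (use Cons.prems in auto)
  show ?case
    by (rule exec_WhileI[OF 1 IH])
       (use Cons.prems in \<open>auto simp: emitted_append emitted_Cons funpow_swap1 algebra_simps\<close>)
qed

fun raw2 :: "nat \<Rightarrow> gate2 \<Rightarrow> (nat \<times> nat list) list" where
  "raw2 f (Gate2 c gs) = bit_raw f (bits c) @ concat (map (raw1 f) gs)"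

text \<open>The first pass also writes an empty polynomial: its value 0 gives the summand 1 in Mod 3
  z = 1 + \<alpha>^z + \<alpha>^(2z). After the digits the register depends on their number and is
  set back to \<open>f\<close>.\<close>

definition gate2_com :: "nat \<Rightarrow> com" where
  "gate2_com f = (if f = 1 then emit 4 ;; emit 5 else skip) ;; emit 4 ;;
     While 0 (\<lambda>x. x \<noteq> 3) bit_com ;; set_reg f ;; mv 0 1 ;; mv 0 1 ;;
     While 0 (\<lambda>x. x \<noteq> 5) (gate1_com f) ;; mv 0 1 ;; emit 5"

text \<open>Serial numbers run on through the whole system, so the counter is never reset between
  polynomials.\<close>

fun numbered_system :: "nat \<Rightarrow> nat \<Rightarrow> (nat \<times> nat list) list list \<Rightarrow> expanded_poly list" where
  "numbered_system L k [] = []"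
| "numbered_system L k (ms # mss) = numbered L k ms # numbered_system L (k + length ms) mss"

definition raw_gate :: "nat \<Rightarrow> gate2 \<Rightarrow> (nat \<times> nat list) list list" where
  "raw_gate f g = (if f = 1 then [[]] else []) @ [raw2 f g]"

definition emitted_system :: "nat \<Rightarrow> nat \<Rightarrow> (nat \<times> nat list) list list \<Rightarrow> nat list" where
  "emitted_system L k mss = concat (map (enc_list enc_monomial) (numbered_system L k mss))"

lemma emitted_system_Nil [simp]: "emitted_system L k [] = []"
  by (simp add: emitted_system_def)

lemma emitted_system_Cons:
  "emitted_system L k (ms # mss) = [4] @ emitted L k ms @ [5] @ emitted_system L (k + length ms) mss"
  by (simp add: emitted_system_def emitted_def enc_list_def)

lemma emitted_system_append:
  "emitted_system L k (mss @ mss') = emitted_system L k mss @ emitted_system L (k + length (concat mss)) mss'"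
  by (induction mss arbitrary: k) (auto simp: emitted_system_Cons add_ac)

lemma exec_gate2:
  assumes "f \<in> {1, 2}" "k + length (raw2 f g) \<le> L" "wf_gate2 n g" "n \<le> L \<or> g = Gate2 c []" "g = Gate2 c gs"
  shows "exec (gate2_com f) (st L l (enc_gate2 g @ x) f k b) ((16 * L + 80) * length (enc_gate2 g))
     (st L (rev (enc_gate2 g) @ l) x f (k + length (raw2 f g)) (rev (emitted_system L k (raw_gate f g)) @ b))"
proof -
  let ?r1 = "bit_raw f (bits c)"
  let ?r2 = "concat (map (raw1 f) gs)"
  let ?G = "concat (map enc_gate1 gs)"
  let ?b0 = "rev (if f = 1 then [4, 5] else []) @ b"
  have enc: "enc_gate2 g @ x = bits c @ 3 # 4 # ?G @ 5 # x"
    by (simp add: assms(5) enc_list_def enc_nat_def)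
  have 1: "exec (if f = 1 then emit 4 ;; emit 5 else skip) [i, u, ([], [f]), (b, [])] (1 + 1)
     [i, u, ([], [f]), (?b0, [])]" for i u
  proof (cases "f = 1")
    case True
    have "exec (emit 4 ;; emit 5) [i, u, ([], [f]), (b, [])] (1 + 1) [i, u, ([], [f]), (5 # 4 # b, [])]"
      by (rule exec.Seq exec_basic)+
    then show ?thesis using True by simp
  next
    case False
    then show ?thesis using exec.weaken[OF exec_basic(6), of "Suc (Suc 0)"] by simp
  qed
  have 2: "exec (While 0 (\<lambda>x. x \<noteq> 3) bit_com) (st L l (bits c @ 3 # x) f k b)
     ((8 * L + 19) * length (bits c) + 1)
     (st L (rev (bits c) @ l) (3 # x) (((\<lambda>x. 3 - x) ^^ length (bits c)) f) (k + length ?r1)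
       (rev (emitted L k ?r1) @ b))" for l x b
    by (rule exec_bits) (use assms set_bits in auto)
  have 3: "exec (While 0 (\<lambda>x. x \<noteq> 5) (gate1_com f)) (st L l (?G @ 5 # x) f (k + length ?r1) b)
     ((16 * L + 61) * length ?G + 1)
     (st L (rev ?G @ l) (5 # x) f (k + length ?r1 + length ?r2) (rev (emitted L (k + length ?r1) ?r2) @ b))" for l b
    by (rule exec_gates1[where n = n]) (use assms in auto)
  let ?t = "12 + (16 * L + 61) * length (enc_gate2 g)"
  have d: "(8 * L + 19) * length (bits c) \<le> (16 * L + 61) * length (bits c)"
    by (intro mult_right_mono) auto
  have t: "1 + 1 + (1 + ((8 * L + 19) * length (bits c) + 1 + (1 + (1 + (1 +
      ((16 * L + 61) * length ?G + 1 + (1 + 1))))))) \<le> ?t"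
    by (simp add: assms(5) enc_list_def enc_nat_def add_mult_distrib2) (use d in linarith)
  have "exec (gate2_com f) (st L l (enc_gate2 g @ x) f k b) ?t
     (st L (rev (enc_gate2 g) @ l) x f (k + length (raw2 f g)) (rev (emitted_system L k (raw_gate f g)) @ b))"
    unfolding gate2_com_def enc
    by (rule exec_eqI, (rule exec.Seq 1 2 3 exec_basic)+, rule t)
       (simp add: assms(5) raw_gate_def emitted_system_Cons emitted_append enc_list_def enc_nat_def add.assoc)
  moreover have "?t \<le> (16 * L + 80) * length (enc_gate2 g)"
    using time_bound[of "length (enc_gate2 g)" 12 "16 * L + 61" "16 * L + 80" 0] by (simp add: assms(5) enc_nat_def)
  ultimately show ?thesis by (rule exec.weaken)
qed

lemma exec_gates2:
  assumes "f \<in> {1, 2}" "k + length (concat (map (raw2 f) gs)) \<le> L" "\<forall>g\<in>set gs. wf_gate2 n g"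
    and "\<forall>c es. Gate2 c es \<in> set gs \<longrightarrow> n \<le> L \<or> es = []"
  shows "exec (While 0 (\<lambda>x. x \<noteq> 5) (gate2_com f)) (st L l (concat (map enc_gate2 gs) @ 5 # x) f k b)
     ((16 * L + 81) * length (concat (map enc_gate2 gs)) + 1)
     (st L (rev (concat (map enc_gate2 gs)) @ l) (5 # x) f (k + length (concat (map (raw2 f) gs)))
       (rev (emitted_system L k (concat (map (raw_gate f) gs))) @ b))"
  using assms
proof (induction gs arbitrary: k l b)
  case Nil
  then show ?case using exec.WhileF[of "\<lambda>x. x \<noteq> 5" _ 0] by simp
next
  case (Cons g gs)
  obtain c es where g: "g = Gate2 c es" by (cases g)
  have L: "k + length (raw2 f g) \<le> L" "wf_gate2 n g" "n \<le> L \<or> g = Gate2 c []"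
    using Cons.prems g by auto
  have IH: "exec (While 0 (\<lambda>x. x \<noteq> 5) (gate2_com f)) (st L l (concat (map enc_gate2 gs) @ 5 # x) f (k + length (raw2 f g)) b)
     ((16 * L + 81) * length (concat (map enc_gate2 gs)) + 1)
     (st L (rev (concat (map enc_gate2 gs)) @ l) (5 # x) f (k + length (raw2 f g) + length (concat (map (raw2 f) gs)))
       (rev (emitted_system L (k + length (raw2 f g)) (concat (map (raw_gate f) gs))) @ b))" for l b
    by (rule Cons.IH) (use Cons.prems in auto)
  have pos: "length (enc_gate2 g) > 0" by (simp add: g enc_nat_def)
  have raw: "length (concat (raw_gate f g)) = length (raw2 f g)" by (simp add: raw_gate_def)
  have scan: "nth0 (enc_gate2 g @ y) 0 \<noteq> 5" for y by (simp add: g enc_nat_scan)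
  show ?case
    by (rule exec_WhileI[OF exec_gate2[OF assms(1) L g] IH])
       (use raw pos scan in \<open>auto simp: emitted_system_append algebra_simps Suc_le_eq\<close>)
qed

section \<open>The reduction program\<close>

lemma set_enc_list: "(\<And>x. x \<in> set xs \<Longrightarrow> set (e x) \<subseteq> {1..<6}) \<Longrightarrow> set (enc_list e xs) \<subseteq> {1..<6}"
  by (fastforce simp: enc_list_def)

lemma set_enc_nat': "set (enc_nat n) \<subseteq> {1..<6}"
  using set_enc_nat[of n] by auto

lemma set_enc_gate1: "set (enc_gate1 g) \<subseteq> {1..<6}"
  by (cases g) (simp add: set_enc_nat' set_enc_list del: One_nat_def)

lemma set_enc_gate2: "set (enc_gate2 g) \<subseteq> {1..<6}"
  by (cases g) (simp add: set_enc_nat' set_enc_list set_enc_gate1 del: One_nat_def)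

lemma set_enc_circuit: "set (enc_circuit C) \<subseteq> {1..<6}"
  by (cases C) (simp add: set_enc_nat' set_enc_list set_enc_gate2 del: One_nat_def)

lemma set_enc_poly_system: "set (enc_poly_system S) \<subseteq> {1..<6}"
proof -
  have "set (enc_monomial m) \<subseteq> {1..<6}" for m
    by (cases m) (simp add: enc_monomial_def set_enc_nat' set_enc_list del: One_nat_def)
  then show ?thesis
    by (cases S) (simp add: enc_poly_system_def set_enc_nat' set_enc_list del: One_nat_def)
qed

lemma length_le_concat: "x \<in> set xs \<Longrightarrow> length (e x) \<le> length (concat (map e xs))"
  by (induction xs) auto

lemma length_concat_mono:
  "(\<And>x. x \<in> set xs \<Longrightarrow> length (e x) \<le> length (e' x)) \<Longrightarrow> length (concat (map e xs)) \<le> length (concat (map e' xs))"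
  by (induction xs) (auto intro: add_mono)

lemma length_encs: "length es \<le> length (encs es)"
  by (induction es) (auto simp: length_enc_nat)

lemma inputs_le_enc_gate1: "wf_gate1 n g \<Longrightarrow> n \<le> length (enc_gate1 g)"
  using length_encs by (cases g) (auto simp: enc_list_def intro: le_SucI trans_le_add2)

lemma length_raw1: "length (raw1 f g) \<le> length (enc_gate1 g)"
  by (cases g) (simp add: enc_list_def)

text \<open>A digit gives at most one monomial, and a gate at depth 1 gives two, while its code has
  at least three symbols.\<close>

lemma length_raw2: "length (raw2 f g) \<le> length (enc_gate2 g)"
proof -
  have "length (bit_raw f ds) \<le> length ds" for ds
    by (induction f ds rule: bit_raw.induct) auto
  moreover obtain c gs where "g = Gate2 c gs" by (cases g)
  moreover have "length (concat (map (raw1 f) gs)) \<le> length (concat (map enc_gate1 gs))"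
    by (rule length_concat_mono) (rule length_raw1)
  ultimately show ?thesis
    by (simp add: enc_list_def enc_nat_def add_mono le_SucI)
qed

text \<open>Only the parity of the outermost constant survives in characteristic 2. If it is odd, an
  empty polynomial in the first pass contributes the summand 1.\<close>

fun raw_pass :: "nat \<Rightarrow> circuit \<Rightarrow> (nat \<times> nat list) list list" where
  "raw_pass f (Circuit n c gs) = (if f = 1 \<and> odd c then [[]] else []) @ concat (map (raw_gate f) gs)"

lemma concat_raw_pass: "concat (raw_pass f (Circuit n c gs)) = concat (map (raw2 f) gs)"
  by (induction gs) (auto simp: raw_gate_def)

lemma length_raw_pass: "length (concat (raw_pass f C)) \<le> length (enc_circuit C)"
proof (cases C)
  case (Circuit n c gs)
  have "length (concat (map (raw2 f) gs)) \<le> length (concat (map enc_gate2 gs))"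
    by (rule length_concat_mono) (rule length_raw2)
  then show ?thesis unfolding Circuit concat_raw_pass by (simp add: enc_list_def)
qed

text \<open>A single gate at depth 1 lists \<open>n\<close> multiplicities, each with at least one
  symbol.\<close>

lemma inputs_le_enc:
  assumes "wf_circuit (Circuit n c gs)" "Gate2 c' hs \<in> set gs" "h \<in> set hs"
  shows "n \<le> length (enc_circuit (Circuit n c gs))"
proof -
  have "n \<le> length (enc_gate1 h)"
    using assms by (intro inputs_le_enc_gate1) fastforce
  also have "\<dots> \<le> length (concat (map enc_gate1 hs))"
    by (rule length_le_concat) fact
  also have "\<dots> \<le> length (enc_gate2 (Gate2 c' hs))"
    by (simp add: enc_list_def)
  also have "\<dots> \<le> length (concat (map enc_gate2 gs))"
    by (rule length_le_concat) fact
  also have "\<dots> \<le> length (enc_circuit (Circuit n c gs))"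
    by (simp add: enc_list_def)
  finally show ?thesis .
qed

section \<open>One pass over the circuit\<close>

definition pass_com :: "nat \<Rightarrow> com" where
  "pass_com f = set_reg f ;; skip_num ;;
     (if f = 1 then Cond 0 (\<lambda>x. x = 2) (emit 4 ;; emit 5) skip else skip) ;; skip_num ;; mv 0 1 ;;
     While 0 (\<lambda>x. x \<noteq> 5) (gate2_com f) ;; rewind 0"

lemma exec_pass:
  assumes "f \<in> {1, 2}" "wf_circuit C" "k + length (concat (raw_pass f C)) \<le> L" "length (enc_circuit C) \<le> L"
  shows "exec (pass_com f) (st L [0] (enc_circuit C @ [0]) f' k b) ((16 * L + 90) * length (enc_circuit C) + 20)
     (st L [0] (enc_circuit C @ [0]) f (k + length (concat (raw_pass f C)))
       (rev (emitted_system L k (raw_pass f C)) @ b))"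
proof -
  obtain n c gs where C: "C = Circuit n c gs" by (cases C)
  let ?G = "concat (map enc_gate2 gs)"
  let ?b0 = "rev (if f = 1 \<and> odd c then [4, 5] else []) @ b"
  have enc: "enc_circuit C @ [0] = enc_nat n @ enc_nat c @ 4 # ?G @ 5 # [0]"
    by (simp add: C enc_list_def)
  have 1: "exec (if f = 1 then Cond 0 (\<lambda>x. x = 2) (emit 4 ;; emit 5) skip else skip)
     [(l, enc_nat c @ x), u, ([], [f]), (b, [])] 3 [(l, enc_nat c @ x), u, ([], [f]), (?b0, [])]" for l x u
  proof (cases "f = 1")
    case True
    let ?s = "[(l, enc_nat c @ x), u, ([], [f]), (b, [])]"
    have e: "exec (emit 4 ;; emit 5) ?s 2 [(l, enc_nat c @ x), u, ([], [f]), (5 # 4 # b, [])]"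
      by (rule exec_eqI, (rule exec.Seq exec_basic)+) simp_all
    have "exec (Cond 0 (\<lambda>x. x = 2) (emit 4 ;; emit 5) skip) ?s (Suc 2) [(l, enc_nat c @ x), u, ([], [f]), (?b0, [])]"
      by (rule exec_CondI) (use e exec.weaken[OF exec_basic(6), of 2] True in \<open>simp_all add: enc_nat_scan\<close>)
    then show ?thesis using True by simp
  next
    case False
    then show ?thesis using exec.weaken[OF exec_basic(6), of 3] by simp
  qed
  have 2: "exec (While 0 (\<lambda>x. x \<noteq> 5) (gate2_com f)) (st L l (?G @ 5 # x) f k b)
     ((16 * L + 81) * length ?G + 1)
     (st L (rev ?G @ l) (5 # x) f (k + length (concat (map (raw2 f) gs)))
       (rev (emitted_system L k (concat (map (raw_gate f) gs))) @ b))" for l x b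
  proof (rule exec_gates2[where n = n])
    show "\<forall>c es. Gate2 c es \<in> set gs \<longrightarrow> n \<le> L \<or> es = []"
    proof (intro allI impI)
      fix c' es assume "Gate2 c' es \<in> set gs"
      then show "n \<le> L \<or> es = []"
        using inputs_le_enc[of n c gs c' es "hd es"] assms(2,4) C by (cases es) auto
    qed
  qed (use assms C in \<open>auto simp: concat_raw_pass simp del: raw_pass.simps\<close>)
  \<comment> \<open>The loop ends on the last bracket of the input; the word before it has no blank,
    so rewinding stops at the left marker.\<close>
  let ?w = "enc_nat n @ enc_nat c @ 4 # ?G"
  have "0 \<notin> set (enc_circuit C)" using set_enc_circuit[of C] by auto
  then have nz: "0 \<notin> set ?w" by (simp add: C enc_list_def)
  have 3: "exec (rewind 0) [(rev ?G @ 4 # rev (enc_nat c) @ rev (enc_nat n) @ [0], 5 # [0]), u, v, z]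
      (2 * length ?w + 3) [([0], ?w @ 5 # [0]), u, v, z]" for u v z
    using exec_rewind[of 0 "[(rev ?w @ [0], 5 # [0]), u, v, z]" ?w "5 # [0]"] nz by simp
  have t: "1 + (2 * length (enc_nat n) + (3 + (2 * length (enc_nat c) + (1 + ((16 * L + 81) * length ?G + 1 + (2 * length ?w + 3))))))
    \<le> (16 * L + 90) * length (enc_circuit C) + 20"
    by (simp add: C enc_list_def add_mult_distrib2 add_mult_distrib)
  have eq: "rev (emitted_system L k (concat (map (raw_gate f) gs))) @ ?b0 = rev (emitted_system L k (raw_pass f C)) @ b"
    by (simp add: C emitted_system_append emitted_system_Cons)
  have cat: "concat (raw_pass f C) = concat (map (raw2 f) gs)"
    unfolding C by (rule concat_raw_pass)
  show ?thesis
    unfolding pass_com_def enc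
    by (rule exec_eqI, (rule exec.Seq exec_basic(4) exec_skip_num 1 exec_basic(1) 2 3)+, rule t)
       (simp only: eq cat append_assoc append.simps)
qed

section \<open>Binary counting and initialization\<close>

lemma bits_Suc:
  "\<exists>c r. bits m = replicate c 2 @ r \<and> nth0 r 0 \<noteq> 2 \<and> bits (Suc m) = replicate c 1 @ 2 # tl r \<and> c \<le> m"
proof (induction m rule: less_induct)
  case (less m)
  consider "m = 0" | j where "j > 0" "m = 2 * j" | j where "m = Suc (2 * j)"
    by (cases "even m"; cases "m = 0") (auto elim!: evenE oddE)
  then show ?case
  proof cases
    case 1
    then show ?thesis using bits_double_Suc[of 0] by (intro exI[of _ 0] exI[of _ "[]"]) simp
  next
    case 2
    then show ?thesis
      by (intro exI[of _ 0] exI[of _ "1 # bits j"]) (simp add: bits_double bits_double_Suc)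
  next
    case 3
    obtain c r where "bits j = replicate c 2 @ r" "nth0 r 0 \<noteq> 2" "bits (Suc j) = replicate c 1 @ 2 # tl r" "c \<le> j"
      using less[of j] 3 by auto
    then show ?thesis
      using 3 bits_double[of "Suc j"] by (intro exI[of _ "Suc c"] exI[of _ r]) (simp add: bits_double_Suc)
  qed
qed

lemma length_bits: "length (bits m) \<le> m"
proof (induction m rule: bits.induct)
  case (1 n)
  show ?case
  proof (cases "n = 0")
    case False
    then have "length (bits n) = Suc (length (bits (n div 2)))" by (subst bits.simps) simp
    moreover have "Suc (n div 2) \<le> n" using False by simp
    ultimately show ?thesis using 1[OF False] by simp
  qed simp
qed

text \<open>Carry propagation: leading digits one (symbol \<open>2\<close>) become zero (symbol
  \<open>1\<close>), and the next cell becomes \<open>2\<close>. In \<open>bits_Suc\<close> the term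
  \<open>tl r\<close> also covers a number that gains a digit, where that cell was blank.\<close>

definition incr_com :: com where
  "incr_com = While 3 (\<lambda>x. x = 2) (Act 3 (\<lambda>_. 1) 1) ;; Act 3 (\<lambda>_. 2) 0 ;; rewind 3"

lemma exec_carry:
  assumes "nth0 r 0 \<noteq> 2"
  shows "exec (While 3 (\<lambda>x. x = 2) (Act 3 (\<lambda>_. 1) 1)) [i, u, f, (l, replicate c 2 @ r)] (2 * c + 1)
     [i, u, f, (replicate c 1 @ l, r)]"
proof (induction c arbitrary: l)
  case 0
  then show ?case using exec.WhileF[of "\<lambda>x. x = 2" "[i, u, f, (l, r)]" 3] assms by (simp add: numeral_3_eq_3)
next
  case (Suc c)
  have "exec (Act 3 (\<lambda>_. 1) 1) [i, u, f, (l, 2 # replicate c 2 @ r)] 1 [i, u, f, (1 # l, replicate c 2 @ r)]"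
    by (rule exec_ActI) (simp_all add: numeral_3_eq_3)
  then show ?case
    by (rule exec_WhileI[OF _ Suc.IH]) (auto simp: numeral_3_eq_3 replicate_app_Cons_same)
qed

lemma exec_incr:
  "exec incr_com [i, u, f, ([0], bits m)] (4 * m + 5) [i, u, f, ([0], bits (Suc m))]"
proof -
  obtain c r where c: "bits m = replicate c 2 @ r" "nth0 r 0 \<noteq> 2" "bits (Suc m) = replicate c 1 @ 2 # tl r" "c \<le> m"
    using bits_Suc by blast
  have 1: "exec (Act 3 (\<lambda>_. 2) 0) [i, u, f, (replicate c 1 @ [0], r)] 1 [i, u, f, (replicate c 1 @ [0], 2 # tl r)]"
    by (rule exec_ActI) (simp_all add: numeral_3_eq_3)
  have 2: "exec (rewind 3) [i, u, f, (replicate c 1 @ [0], 2 # tl r)] (2 * c + 3) [i, u, f, ([0], replicate c 1 @ 2 # tl r)]"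
    using exec_rewind[of 3 "[i, u, f, (replicate c 1 @ [0], 2 # tl r)]" "replicate c 1" "2 # tl r"]
    by (auto simp: numeral_3_eq_3)
  show ?thesis
    unfolding incr_com_def c(1,3)
    by (rule exec_eqI[OF exec.Seq[OF exec_carry[OF c(2)] exec.Seq[OF 1 2]]]) (use c(4) in auto)
qed

text \<open>Per input symbol, two cells are added to the counter and 4 to the binary number of
  variables, which is built in place as the beginning of the output.\<close>

definition count_com :: com where
  "count_com = Act 1 (\<lambda>_. 1) 1 ;; Act 1 (\<lambda>_. 1) 1 ;; incr_com ;; incr_com ;; incr_com ;; incr_com ;; mv 0 1"

text \<open>\<open>j\<close> counts the symbols already read, and \<open>B\<close> bounds all
  numbers that get incremented, so that the increments have a uniform cost.\<close>

lemma exec_count: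
  assumes "0 \<notin> set x" "4 * (j + length x) \<le> B"
  shows "exec (While 0 (\<lambda>x. x \<noteq> 0) count_com)
     [(l, x), (replicate (2 * j) 1 @ [0], []), ([], [1]), ([0], bits (4 * j))] ((16 * B + 24) * length x + 1)
     [(rev x @ l, []), (replicate (2 * (j + length x)) 1 @ [0], []), ([], [1]), ([0], bits (4 * (j + length x)))]"
  using assms
proof (induction x arbitrary: l j)
  case Nil
  then show ?case using exec.WhileF[of "\<lambda>x. x \<noteq> 0" _ 0] by simp
next
  case (Cons a x)
  have 1: "exec (Act 1 (\<lambda>_. 1) 1) [i, (u, []), f, w] 1 [i, (1 # u, []), f, w]" for i u f w
    by (rule exec_ActI) simp_all
  have 2: "exec incr_com [i, u, f, ([0], bits m)] (4 * B + 5) [i, u, f, ([0], bits (Suc m))]" if "m \<le> B" for i u f m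
    by (rule exec_eqI[OF exec_incr]) (use that in auto)
  let ?m = "4 * j"
  have m: "?m \<le> B" "Suc ?m \<le> B" "Suc (Suc ?m) \<le> B" "Suc (Suc (Suc ?m)) \<le> B" using Cons.prems by auto
  have 3: "exec count_com [(l, a # x), (replicate (2 * j) 1 @ [0], []), ([], [1]), ([0], bits (4 * j))]
     (1 + (1 + (4 * B + 5 + (4 * B + 5 + (4 * B + 5 + (4 * B + 5 + 1))))))
     [(a # l, x), (1 # 1 # replicate (2 * j) 1 @ [0], []), ([], [1]), ([0], bits (Suc (Suc (Suc (Suc ?m)))))]"
    unfolding count_com_def
    by (rule exec.Seq[OF 1 exec.Seq[OF 1 exec.Seq[OF 2[OF m(1)] exec.Seq[OF 2[OF m(2)]
          exec.Seq[OF 2[OF m(3)] exec.Seq[OF 2[OF m(4)] exec_basic(1)]]]]]])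
  have 4: "Suc (Suc (Suc (Suc ?m))) = 4 * Suc j" "1 # 1 # replicate (2 * j) 1 @ [0] = replicate (2 * Suc j) (1::nat) @ [0]" by simp_all
  show ?case
    by (rule exec_WhileI[OF 3[unfolded 4] Cons.IH]) (use Cons.prems in \<open>auto simp: algebra_simps\<close>)
qed

text \<open>The first moves create explicit blanks to the left of tapes 0, 1 and 3, the markers at
  which rewinding stops. After counting, \<open>3\<close> ends the number of variables and
  \<open>4\<close> opens the list of polynomials.\<close>

definition init_com :: com where
  "init_com = mv 0 (-1) ;; mv 0 1 ;; mv 1 1 ;; mv 3 1 ;; set_reg 1 ;; While 0 (\<lambda>x. x \<noteq> 0) count_com ;;
     While 3 (\<lambda>x. x \<noteq> 0) (mv 3 1) ;; emit 3 ;; emit 4 ;; rewind 0 ;; rewind 1"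

lemma exec_init:
  assumes "0 \<notin> set w" "w \<noteq> []" "N = length w"
  shows "exec init_com [([], w), ([], []), ([], []), ([], [])] (64 * N * N + 38 * N + 20)
     (st (2 * N) [0] (w @ [0]) 1 0 (rev (enc_nat (4 * N) @ [4]) @ [0]))"
proof -
  have 1: "exec (mv 0 (-1)) [([], w), u, f, b] 1 [([], 0 # w), u, f, b]" for u f b
    by (rule exec_ActI) (use assms(2) in \<open>cases w; simp\<close>)+
  have 2: "exec (mv 1 1) [i, ([], []), f, b] 1 [i, ([0], []), f, b]" for i f b
    by (rule exec_ActI) simp_all
  have 3: "exec (mv 3 1) [i, u, f, ([], [])] 1 [i, u, f, ([0], [])]" for i u f
    by (rule exec_ActI) (simp_all add: numeral_3_eq_3)
  have 4: "exec (set_reg 1) [i, u, ([], []), b] 1 [i, u, ([], [1]), b]" for i u b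
    by (rule exec_ActI) (simp_all add: numeral_2_eq_2)
  have 5: "exec (While 0 (\<lambda>x. x \<noteq> 0) count_com) [([0], w), ([0], []), ([], [1]), ([0], [])]
     ((64 * N + 24) * N + 1)
     [(rev w @ [0], []), (replicate (2 * N) 1 @ [0], []), ([], [1]), ([0], bits (4 * N))]"
    using exec_count[OF assms(1), of 0 "4 * N" "[0]"] assms(3) by simp
  have nz: "\<forall>a\<in>set (bits (4 * N)). a \<noteq> 0" using set_bits[of "4 * N"] by auto
  have le: "2 * length (bits (4 * N)) + 1 \<le> 8 * N + 1" using length_bits[of "4 * N"] by simp
  have 6: "exec (While 3 (\<lambda>x. x \<noteq> 0) (mv 3 1)) [i, u, f, ([0], bits (4 * N))] (8 * N + 1)
     [i, u, f, (rev (bits (4 * N)) @ [0], [])]" for i u f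
    using exec_right[of 3 "[i, u, f, ([0], bits (4 * N))]" "[0]" "bits (4 * N)" "[]" "\<lambda>x. x \<noteq> 0", OF _ _ nz]
    by (intro exec.weaken[OF _ le]) (simp add: numeral_3_eq_3)
  have 7: "exec (rewind 0) [(rev w @ [0], []), u, f, b] (2 * N + 3) [([0], w @ [0]), u, f, b]" for u f b
    using exec_rewind[of 0 "[(rev w @ [0], []), u, f, b]" w "[]"] assms by simp
  have 8: "exec (rewind 1) [i, (replicate (2 * N) 1 @ [0], []), f, b] (4 * N + 3) [i, ([0], thermo (2 * N) 0 @ [0]), f, b]" for i f b
    using exec_rewind[of 1 "[i, (replicate (2 * N) 1 @ [0], []), f, b]" "replicate (2 * N) 1" "[]"]
    by (auto simp: thermo_def)
  note seq = exec.Seq[OF 1 exec.Seq[OF exec_basic(1) exec.Seq[OF 2 exec.Seq[OF 3 exec.Seq[OF 4 exec.Seq[OF 5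
    exec.Seq[OF 6 exec.Seq[OF exec_basic(3) exec.Seq[OF exec_basic(3) exec.Seq[OF 7 8]]]]]]]]]]
  show ?thesis
    unfolding init_com_def
    by (rule exec_eqI[OF seq]) (auto simp: algebra_simps enc_nat_def)
qed

section \<open>The complete program\<close>

definition main_com :: com where
  "main_com = (init_com ;; pass_com 1 ;; pass_com 2 ;; emit 5) ;; rewind 3"

text \<open>Each of the two passes produces at most \<open>N\<close> monomials, so
  \<open>2 * N\<close> dummy variables suffice for the serial numbers. As many ordinary variables
  make room for all exponents occurring in gates.\<close>

definition reduction :: "circuit \<Rightarrow> nat \<times> expanded_poly list" where
  "reduction C = (let N = length (enc_circuit C) in
     (4 * N, numbered_system (2 * N) 0 (raw_pass 1 C @ raw_pass 2 C)))"

lemma enc_reduction: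
  "enc_poly_system (reduction C) = (let N = length (enc_circuit C) in
     enc_nat (4 * N) @ [4] @ emitted_system (2 * N) 0 (raw_pass 1 C @ raw_pass 2 C) @ [5])"
  by (simp add: enc_poly_system_def reduction_def emitted_system_def enc_list_def Let_def)

lemma exec_main:
  assumes "wf_circuit C" "N = length (enc_circuit C)"
  shows "\<exists>u f i. exec main_com [([], enc_circuit C), ([], []), ([], []), ([], [])] (384 * N * N + 654 * N + 190)
     [i, u, f, ([0], enc_poly_system (reduction C) @ [0])]"
proof -
  let ?w = "enc_circuit C" and ?L = "2 * N"
  \<comment> \<open>The sum of the bounds for the initialization, for two passes of (32 * N + 90) *
    N + 20 steps, and for the closing bracket.\<close>
  let ?T = "128 * N * N + 218 * N + 61"
  let ?s = "[([], ?w), ([], []), ([], []), ([], [])]"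
  let ?k = "length (concat (raw_pass 1 C))"
  let ?y = "enc_poly_system (reduction C)"
  have nz: "0 \<notin> set ?w" using set_enc_circuit[of C] by auto
  have ne: "?w \<noteq> []" by (cases C) (simp add: enc_nat_def)
  have len: "length (concat (raw_pass f C)) \<le> N" for f using length_raw_pass assms(2) by simp
  note 1 = exec_init[OF nz ne assms(2)]
  have 2: "exec (pass_com 1) (st ?L [0] (?w @ [0]) 1 0 b) ((16 * ?L + 90) * N + 20)
    (st ?L [0] (?w @ [0]) 1 (0 + ?k) (rev (emitted_system ?L 0 (raw_pass 1 C)) @ b))" for b
    using exec_pass[of 1 C 0 ?L] len[of 1] assms by simp
  have 3: "exec (pass_com 2) (st ?L [0] (?w @ [0]) 1 (0 + ?k) b) ((16 * ?L + 90) * N + 20)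
    (st ?L [0] (?w @ [0]) 2 (0 + ?k + length (concat (raw_pass 2 C))) (rev (emitted_system ?L (0 + ?k) (raw_pass 2 C)) @ b))" for b
    using exec_pass[of 2 C "0 + ?k" ?L] len[of 1] len[of 2] assms by simp
  note seq = exec.Seq[OF 1 exec.Seq[OF 2 exec.Seq[OF 3 exec_basic(3)[of 5]]]]
  define i u f where "i = ([0::nat], ?w @ [0])"
    and "u = ([0::nat], thermo ?L (0 + ?k + length (concat (raw_pass 2 C))) @ [0])" and "f = ([] :: nat list, [2::nat])"
  have eq: "5 # rev (emitted_system ?L (0 + ?k) (raw_pass 2 C)) @ rev (emitted_system ?L 0 (raw_pass 1 C)) @
      rev (enc_nat (4 * N) @ [4]) @ [0] = rev ?y @ [0]"
    by (simp add: enc_reduction Let_def emitted_system_append assms(2))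
  have 4: "exec (init_com ;; pass_com 1 ;; pass_com 2 ;; emit 5) ?s ?T [i, u, f, (rev ?y @ [0], [])]"
    unfolding i_def u_def f_def
    by (rule exec_eqI[OF seq]) (simp add: algebra_simps, simp only: eq)
  have y: "0 \<notin> set ?y" using set_enc_poly_system[of "reduction C"] by auto
  \<comment> \<open>All of the output was written within \<open>?T\<close> steps, so rewinding it
    costs at most \<open>2 * ?T + 3\<close>.\<close>
  have "length ?y \<le> ?T"
    using exec_length_left[OF 4, of 3] by (simp add: numeral_3_eq_3)
  then have le: "2 * length ?y + 3 \<le> 2 * ?T + 3" by simp
  have 5: "exec (rewind 3) [i, u, f, (rev ?y @ [0], [])] (2 * ?T + 3) [i, u, f, ([0], ?y @ [0])]"
    using exec_rewind[of 3 "[i, u, f, (rev ?y @ [0], [])]" ?y "[]"] y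
    by (intro exec.weaken[OF _ le]) (simp add: numeral_3_eq_3)
  have "exec main_com ?s (384 * N * N + 654 * N + 190) [i, u, f, ([0], ?y @ [0])]"
    unfolding main_com_def by (rule exec_eqI[OF exec.Seq[OF 4 5]]) simp_all
  then show ?thesis by blast
qed

section \<open>Correctness of the reduction\<close>

text \<open>The six symbols are the blank and the five symbols of the encoding.\<close>

lemma wf_main_com: "wf_com 4 6 main_com"
  by (auto simp: main_com_def init_com_def count_com_def incr_com_def pass_com_def gate2_com_def gate1_com_def
      bit_com_def emit_const_def emit_coeff_def pad_mark_def skip_num_def exponent_def)

section \<open>Distinctness of the exponent vectors\<close>

definition good_mono :: "nat \<Rightarrow> nat \<times> nat list \<Rightarrow> bool" where
  "good_mono L m \<longleftrightarrow> fst m \<in> {1, 2} \<and> length (snd m) \<le> L \<and> set (snd m) \<subseteq> {0, 1}"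

lemma numbered_simps:
  "numbered L k [] = []" "numbered L k (m # ms) = serial_mono L k m # numbered L (Suc k) ms"
  by (simp_all add: numbered_def)

lemma in_numbered:
  "p \<in> set (numbered L k ms) \<Longrightarrow> \<exists>i m. k \<le> i \<and> i < k + length ms \<and> m \<in> set ms \<and> p = serial_mono L i m"
proof (induction ms arbitrary: k)
  case (Cons m ms)
  then consider "p = serial_mono L k m" | "p \<in> set (numbered L (Suc k) ms)" by (auto simp: numbered_simps)
  then show ?case
  proof cases
    case 1
    then show ?thesis by (intro exI[of _ k] exI[of _ m]) auto
  next
    case 2
    then obtain i m' where "Suc k \<le> i" "i < Suc k + length ms" "m' \<in> set ms" "p = serial_mono L i m'"
      using Cons.IH by blast
    then show ?thesis by (intro exI[of _ i] exI[of _ m']) auto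
  qed
qed (simp add: numbered_simps)

text \<open>The serial number is the number of exponents 2 after the first \<open>L\<close>
  entries.\<close>

lemma mono_serial_inj:
  assumes "snd (serial_mono L i m) = snd (serial_mono L j m')" "length (snd m) \<le> L" "length (snd m') \<le> L"
  shows "i = j"
proof -
  have "drop L (snd (serial_mono L i m)) = replicate i 2 @ replicate (L - i) 0"
    "drop L (snd (serial_mono L j m')) = replicate j 2 @ replicate (L - j) 0"
    using assms(2,3) by (simp_all add: serial_mono_def)
  then have "length (filter ((=) 2) (replicate i (2::nat) @ replicate (L - i) 0)) =
      length (filter ((=) 2) (replicate j (2::nat) @ replicate (L - j) 0))"
    using assms(1) by simp
  then show ?thesis by simp
qed

text \<open>Different serial numbers keep the exponent vectors distinct even if the leading
  exponents coincide.\<close>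

lemma wf_numbered:
  assumes "\<forall>m\<in>set ms. good_mono L m" "k + length ms \<le> L"
  shows "wf_expanded (2 * L) (numbered L k ms)"
proof -
  have "distinct (map snd (numbered L k ms))"
    using assms(1)
  proof (induction ms arbitrary: k)
    case (Cons m ms)
    have "snd (serial_mono L k m) \<noteq> snd p" if p: "p \<in> set (numbered L (Suc k) ms)" for p
    proof -
      obtain i m' where i: "Suc k \<le> i" "m' \<in> set ms" "p = serial_mono L i m'"
        using in_numbered[OF p] by blast
      then show ?thesis
        using mono_serial_inj[of L k m i m'] Cons.prems by (auto simp: good_mono_def)
    qed
    then show ?case using Cons by (auto simp: numbered_simps)
  qed (simp add: numbered_simps)
  moreover have "case p of (c, es) \<Rightarrow> c \<in> {1, 2} \<and> length es = 2 * L \<and> set es \<subseteq> {0, 1, 2}"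
    if p: "p \<in> set (numbered L k ms)" for p
  proof -
    obtain i m where "i < k + length ms" "m \<in> set ms" "p = serial_mono L i m"
      using in_numbered[OF p] by blast
    then show ?thesis
      using assms by (fastforce simp: serial_mono_def good_mono_def dest!: in_set_replicate[THEN iffD1])
  qed
  ultimately show ?thesis unfolding wf_expanded_def by blast
qed

lemma wf_numbered_system:
  assumes "\<forall>ms\<in>set mss. \<forall>m\<in>set ms. good_mono L m" "k + length (concat mss) \<le> L"
  shows "\<forall>p\<in>set (numbered_system L k mss). wf_expanded (2 * L) p"
  using assms
proof (induction mss arbitrary: k)
  case (Cons ms mss)
  then show ?case using Cons.IH[of "k + length ms"] wf_numbered[of ms L k] by simp
qed simp

section \<open>Values of the polynomials at sign vectors\<close>

definition mono_val :: "int list \<Rightarrow> nat \<times> nat list \<Rightarrow> int" where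
  "mono_val a m = int (fst m) * (\<Prod>i<length (snd m). a ! i ^ (snd m ! i))"

abbreviation raw_val :: "int list \<Rightarrow> (nat \<times> nat list) list \<Rightarrow> int" where
  "raw_val a ms \<equiv> (\<Sum>m\<leftarrow>ms. mono_val a m)"

text \<open>Even powers of 1 and -1 are 1; hence padding and serial numbers do not change the value
  of a monomial.\<close>

lemma prod_even_tail:
  fixes a :: "int list"
  assumes "\<forall>e\<in>set w. even e" "\<forall>i<length (v @ w). a ! i \<in> {-1, 1}"
  shows "(\<Prod>i<length (v @ w). a ! i ^ ((v @ w) ! i)) = (\<Prod>i<length v. a ! i ^ (v ! i))"
  using assms
proof (induction w rule: rev_induct)
  case (snoc e w)
  have "a ! length (v @ w) ^ e = 1"
    using snoc.prems by (auto elim!: evenE simp: power_mult)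
  moreover have "(\<Prod>i<length (v @ w). a ! i ^ ((v @ w @ [e]) ! i)) = (\<Prod>i<length (v @ w). a ! i ^ ((v @ w) ! i))"
    by (rule prod.cong) (auto simp: nth_append)
  moreover have "(v @ w @ [e]) ! length (v @ w) = e" by (simp add: nth_append)
  ultimately have "(\<Prod>i<Suc (length (v @ w)). a ! i ^ ((v @ w @ [e]) ! i)) = (\<Prod>i<length v. a ! i ^ (v ! i))"
    using snoc by (simp only: prod.lessThan_Suc) simp
  then show ?case by simp
qed simp

lemma mono_val_mono:
  assumes "length (snd m) \<le> L" "i \<le> L" "length a = 2 * L" "set a \<subseteq> {-1, 1}"
  shows "int (fst (serial_mono L i m)) * (\<Prod>j<length (snd (serial_mono L i m)). a ! j ^ (snd (serial_mono L i m) ! j)) = mono_val a m"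
proof -
  let ?w = "replicate (L - length (snd m)) 0 @ replicate i 2 @ replicate (L - i) (0::nat)"
  have "\<forall>e\<in>set ?w. even e" by (auto dest: in_set_replicate[THEN iffD1])
  moreover have "length (snd m @ ?w) = 2 * L" using assms(1,2) by simp
  moreover have "\<forall>j<2 * L. a ! j \<in> {-1, 1}" using assms(3,4) by (metis nth_mem subsetD)
  ultimately show ?thesis
    using prod_even_tail[of ?w "snd m" a] by (simp add: serial_mono_def mono_val_def)
qed

lemma eval_numbered:
  assumes "\<forall>m\<in>set ms. good_mono L m" "k + length ms \<le> L" "length a = 2 * L" "set a \<subseteq> {-1, 1}"
  shows "eval_expanded (numbered L k ms) a = raw_val a ms mod 3"
proof -
  have "(\<Sum>(c, es)\<leftarrow>numbered L k ms. int c * (\<Prod>m<length es. a ! m ^ (es ! m))) = raw_val a ms"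
    using assms(1,2)
  proof (induction ms arbitrary: k)
    case (Cons m ms)
    then show ?case
      using mono_val_mono[of m L k a] assms(3,4)
      by (simp add: numbered_simps good_mono_def case_prod_beta)
  qed (simp add: numbered_simps)
  then show ?thesis by (simp add: eval_expanded_def)
qed

lemma eval_numbered_system:
  fixes \<alpha> :: "'f::field"
  assumes "\<forall>ms\<in>set mss. \<forall>m\<in>set ms. good_mono L m" "k + length (concat mss) \<le> L"
    and "length a = 2 * L" "set a \<subseteq> {-1, 1}"
  shows "(\<Sum>p\<leftarrow>numbered_system L k mss. \<alpha> ^ nat (eval_expanded p a)) = (\<Sum>ms\<leftarrow>mss. \<alpha> ^ nat (raw_val a ms mod 3))"
  using assms by (induction mss arbitrary: k) (auto simp: eval_numbered)

text \<open>The indicator of an even number s is (1 + (-1)^s) / 2, which is 2 + 2 * (-1)^s modulo 3.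
  Here s is the input sum of the gate, and the product of the signs accounts for its non-constant
  part.\<close>

lemma raw1_val:
  assumes "f \<in> {1, 2}" "\<forall>m<length es. a ! m = (-1) ^ (y ! m)"
  shows "3 dvd raw_val a (raw1 f (Gate1 c es)) - int (f * eval_gate1 y (Gate1 c es))"
proof -
  let ?S = "\<Sum>m<length es. es ! m * y ! m"
  have sgn: "((-1) ^ j) ^ (e mod 2) = (-1 :: int) ^ (e * j)" for e j :: nat
    by (cases "even e") (simp_all add: minus_one_power_iff odd_iff_mod_2_eq_one)
  have "(\<Prod>i<length es. a ! i ^ (es ! i mod 2)) = (\<Prod>i<length es. (-1) ^ (es ! i * y ! i))"
    using assms(2) sgn by (intro prod.cong) simp_all
  also have "\<dots> = (-1) ^ ?S"
    by (simp add: power_sum)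
  finally have P: "(\<Prod>i<length es. a ! i ^ (es ! i mod 2)) = (if even ?S then 1 else -1)"
    by (simp add: minus_one_power_iff)
  show ?thesis
    using assms(1) by (cases "even c"; cases "even ?S") (auto simp: mono_val_def P Mod_def)
qed

text \<open>Removing the lowest digit leaves f * (2 * j), which is (3 - f) * j modulo 3: the toggled
  multiplier applied to the remaining digits.\<close>

lemma bit_raw_val:
  "f \<in> {1, 2} \<Longrightarrow> 3 dvd raw_val a (bit_raw f (bits c)) - int (f * c)"
proof (induction c arbitrary: f rule: less_induct)
  case (less c)
  have f: "3 - f \<in> {1, 2}" using less.prems by auto
  consider "c = 0" | j where "j > 0" "c = 2 * j" | j where "c = Suc (2 * j)"
    by (cases "even c"; cases "c = 0") (auto elim!: evenE oddE)
  then show ?case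
  proof cases
    case 2
    then have "3 dvd raw_val a (bit_raw (3 - f) (bits j)) - int ((3 - f) * j)"
      using less.IH[of j] f by auto
    moreover have "f = 1 \<or> f = 2" using less.prems by auto
    ultimately show ?thesis
      using 2 by (auto simp: bits_double) presburger
  next
    case 3
    then have "3 dvd raw_val a (bit_raw (3 - f) (bits j)) - int ((3 - f) * j)"
      using less.IH[of j] f by auto
    moreover have "f = 1 \<or> f = 2" using less.prems by auto
    ultimately show ?thesis
      using 3 by (auto simp: bits_double_Suc mono_val_def) presburger+
  qed simp
qed

lemma raw2_val:
  assumes "f \<in> {1, 2}" "wf_gate2 n (Gate2 c gs)" "gs \<noteq> [] \<Longrightarrow> \<forall>m<n. a ! m = (-1) ^ (y ! m)"
  shows "raw_val a (raw2 f (Gate2 c gs)) mod 3 = int (f * (c + (\<Sum>g\<leftarrow>gs. eval_gate1 y g))) mod 3"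
proof -
  have "3 dvd raw_val a (concat (map (raw1 f) gs)) - int (f * (\<Sum>g\<leftarrow>gs. eval_gate1 y g))"
    using assms(2,3)
  proof (induction gs)
    case (Cons g gs)
    obtain c' es where g: "g = Gate1 c' es" by (cases g)
    have "3 dvd raw_val a (raw1 f g) - int (f * eval_gate1 y g)"
      unfolding g by (rule raw1_val) (use assms(1) Cons.prems g in auto)
    moreover have "3 dvd raw_val a (concat (map (raw1 f) gs)) - int (f * (\<Sum>g\<leftarrow>gs. eval_gate1 y g))"
      by (rule Cons.IH) (use Cons.prems in auto)
    ultimately have "3 dvd (raw_val a (raw1 f g) - int (f * eval_gate1 y g)) +
        (raw_val a (concat (map (raw1 f) gs)) - int (f * (\<Sum>g\<leftarrow>gs. eval_gate1 y g)))"
      by (rule dvd_add)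
    then show ?case by (simp add: algebra_simps)
  qed simp
  from dvd_add[OF bit_raw_val[OF assms(1), of a c] this]
  show ?thesis unfolding mod_eq_dvd_iff by (simp add: algebra_simps)
qed

section \<open>Arithmetic in the field with four elements\<close>

context
  fixes \<alpha> :: "'f::field"
  assumes card: "card (UNIV :: 'f set) = 4" and prim: "primitive_element \<alpha>"
begin

lemma fin: "finite (UNIV :: 'f set)"
  using card by (intro card_ge_0_finite) simp

text \<open>Translation by 1 permutes the field, so comparing the sums of all elements gives 4 = 0,
  where 4 = 2 * 2.\<close>

lemma char_two: "(2::'f) = 0"
proof -
  have "bij_betw (\<lambda>x::'f. x + 1) UNIV UNIV"
    by (rule bij_betw_byWitness[where f' = "\<lambda>x. x - 1"]) auto
  then have "(\<Sum>x\<in>UNIV. x + 1) = (\<Sum>x\<in>UNIV. x :: 'f)"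
    using sum.reindex_bij_betw[of "\<lambda>x. x + 1" UNIV UNIV "\<lambda>x :: 'f. x"] by simp
  then have "of_nat (card (UNIV :: 'f set)) = (0::'f)"
    using fin by (simp add: sum.distrib)
  then have "(2::'f) * 2 = 0" using card by simp
  then show ?thesis using mult_eq_0_iff by blast
qed

text \<open>Multiplication by \<alpha> permutes the three nonzero elements, and comparing their
  products gives the first claim. If \<alpha> were 1, its powers would exhaust only one of
  them.\<close>

lemma primitive_cube: "\<alpha> ^ 3 = 1" "\<alpha> \<noteq> 1"
proof -
  have G: "{\<alpha> ^ i |i :: nat. True} = UNIV - {0}" using prim by (simp add: primitive_element_def)
  have c: "card (UNIV - {0 :: 'f}) = 3" using card fin by simp
  have "\<alpha> ^ 1 \<in> {\<alpha> ^ i |i :: nat. True}" by blast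
  then have nz: "\<alpha> \<noteq> 0" unfolding G by simp
  have "bij_betw (\<lambda>x. \<alpha> * x) (UNIV - {0}) (UNIV - {0})"
    by (rule bij_betw_byWitness[where f' = "\<lambda>x. x / \<alpha>"]) (use nz in auto)
  then have "(\<Prod>x\<in>UNIV - {0}. \<alpha> * x) = (\<Prod>x\<in>UNIV - {0}. x)"
    using prod.reindex_bij_betw[of "\<lambda>x. \<alpha> * x" "UNIV - {0}" "UNIV - {0}" "\<lambda>x. x"] by simp
  moreover have "(\<Prod>x\<in>UNIV - {0 :: 'f}. x) \<noteq> 0" using fin by simp
  ultimately show "\<alpha> ^ 3 = 1" using c by (simp add: prod.distrib)
  show "\<alpha> \<noteq> 1"
  proof
    assume "\<alpha> = 1"
    then have "UNIV - {0 :: 'f} = {1}" unfolding G[symmetric] by auto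
    then show False using c by simp
  qed
qed

lemma primitive_sum: "1 + \<alpha> + \<alpha>\<^sup>2 = 0"
proof -
  have "(\<alpha> - 1) * (1 + \<alpha> + \<alpha>\<^sup>2) = \<alpha> ^ 3 - 1"
    by (simp add: algebra_simps power2_eq_square power3_eq_cube)
  then show ?thesis using primitive_cube by simp
qed

text \<open>If 3 divides \<open>z\<close>, all three terms are 1, and 3 = 1 in characteristic 2.
  Otherwise the two exponents are 1 and 2 in some order, and the sum is 1 + \<alpha> + \<alpha>^2 =
  0.\<close>

lemma Mod_3_sum:
  "1 + \<alpha> ^ nat (int z mod 3) + \<alpha> ^ nat (int (2 * z) mod 3) = of_nat (Mod 3 z)"
proof -
  have n: "nat (int x mod 3) = x mod 3" for x
    using nat_mod_distrib[of "int x" 3] by simp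
  have "z mod 3 = 0 \<and> 2 * z mod 3 = 0 \<or> z mod 3 = 1 \<and> 2 * z mod 3 = 2 \<or> z mod 3 = 2 \<and> 2 * z mod 3 = 1"
    by presburger
  then show ?thesis
  proof (elim disjE conjE)
    assume "z mod 3 = 0" "2 * z mod 3 = 0"
    moreover have "1 + 1 + 1 = (1::'f)" using char_two by (simp only: one_add_one add_0)
    ultimately show ?thesis by (simp only: n Mod_def dvd_eq_mod_eq_0 power_0) simp
  next
    assume "z mod 3 = 1" "2 * z mod 3 = 2"
    then show ?thesis using primitive_sum by (simp only: n Mod_def dvd_eq_mod_eq_0) simp
  next
    assume "z mod 3 = 2" "2 * z mod 3 = 1"
    moreover have "1 + \<alpha>\<^sup>2 + \<alpha> = 0" using primitive_sum by (simp only: add_ac)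
    ultimately show ?thesis by (simp only: n Mod_def dvd_eq_mod_eq_0) simp
  qed
qed

lemma of_nat_even: "(of_nat x :: 'f) = (if even x then 0 else 1)"
  by (induction x) (simp_all add: char_two)

text \<open>Regrouping both passes by the gates at depth 2 gives the sum inside the output gate,
  which vanishes in characteristic 2 iff it is even. The signs \<open>a\<close> match the bits
  \<open>y\<close> only under \<open>n \<le> 4 * N\<close>, as there may be fewer variables than
  inputs; in that case no gate at depth 1 exists.\<close>

lemma reduction_correct:
  assumes C: "C = Circuit n c gs" and wf: "wf_circuit C" and N: "N = length (enc_circuit C)"
    and a: "length a = 4 * N" "set a \<subseteq> {-1, 1}"
    and y: "n \<le> 4 * N \<Longrightarrow> \<forall>m<n. a ! m = (-1) ^ (y ! m)"
    and good: "\<forall>ms\<in>set (raw_pass 1 C @ raw_pass 2 C). \<forall>m\<in>set ms. good_mono (2 * N) m"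
    and len: "length (concat (raw_pass 1 C @ raw_pass 2 C)) \<le> 2 * N"
  shows "(\<Sum>p\<leftarrow>snd (reduction C). \<alpha> ^ nat (eval_expanded p a)) = 0 \<longleftrightarrow> eval_circuit y C = 1"
proof -
  let ?v = "\<lambda>ms. \<alpha> ^ nat (raw_val a ms mod 3)"
  have "(\<Sum>p\<leftarrow>snd (reduction C). \<alpha> ^ nat (eval_expanded p a)) = (\<Sum>ms\<leftarrow>raw_pass 1 C @ raw_pass 2 C. ?v ms)"
    using eval_numbered_system[OF good, of 0 a] len a by (simp add: reduction_def Let_def N)
  also have "\<dots> = of_nat c + (\<Sum>ms\<leftarrow>concat (map (raw_gate 1) gs). ?v ms) + (\<Sum>ms\<leftarrow>concat (map (raw_gate 2) gs). ?v ms)"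
    by (simp add: C of_nat_even)
  also have "\<dots> = of_nat c + (\<Sum>g\<leftarrow>gs. 1 + ?v (raw2 1 g) + ?v (raw2 2 g))"
  proof -
    have "(\<Sum>ms\<leftarrow>concat (map (raw_gate 1) gs). ?v ms) + (\<Sum>ms\<leftarrow>concat (map (raw_gate 2) gs). ?v ms)
      = (\<Sum>g\<leftarrow>gs. 1 + ?v (raw2 1 g) + ?v (raw2 2 g))"
      by (induction gs) (auto simp: raw_gate_def add_ac)
    then show ?thesis by (simp add: add.assoc)
  qed
  also have "(\<Sum>g\<leftarrow>gs. 1 + ?v (raw2 1 g) + ?v (raw2 2 g)) = (\<Sum>g\<leftarrow>gs. of_nat (eval_gate2 y g))"
  proof (rule arg_cong[where f = sum_list], rule map_cong[OF refl])
    fix g assume g: "g \<in> set gs"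
    obtain c' hs where h: "g = Gate2 c' hs" by (cases g)
    have w: "wf_gate2 n g" using wf C g by simp
    \<comment> \<open>A gate at depth 1 forces \<open>n \<le> N\<close>, so the assumption on
      \<open>y\<close> applies.\<close>
    have ay: "\<forall>m<n. a ! m = (-1) ^ (y ! m)" if "hs \<noteq> []"
      using y inputs_le_enc[of n c gs c' hs "hd hs"] that g h wf C N by simp
    have v: "raw_val a (raw2 f g) mod 3 = int (f * (c' + (\<Sum>g\<leftarrow>hs. eval_gate1 y g))) mod 3" if "f \<in> {1, 2}" for f
      unfolding h by (rule raw2_val[OF that w[unfolded h] ay])
    show "1 + ?v (raw2 1 g) + ?v (raw2 2 g) = of_nat (eval_gate2 y g)"
      using Mod_3_sum[of "c' + (\<Sum>g\<leftarrow>hs. eval_gate1 y g)"] v[of 1] v[of 2] by (simp add: h)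
  qed
  also have "of_nat c + (\<Sum>g\<leftarrow>gs. of_nat (eval_gate2 y g)) = (of_nat (c + (\<Sum>g\<leftarrow>gs. eval_gate2 y g)) :: 'f)"
    by (induction gs) (simp_all add: add_ac)
  finally show ?thesis
    by (simp add: of_nat_even C Mod_def del: of_nat_add)
qed

end

section \<open>Validity of the reduction\<close>

lemma good_raw:
  assumes "wf_circuit C" "N = length (enc_circuit C)" "ms \<in> set (raw_pass f C)" "m \<in> set ms" "f \<in> {1, 2}"
  shows "good_mono (2 * N) m"
proof -
  obtain n c gs where C: "C = Circuit n c gs" by (cases C)
  obtain g where g: "g \<in> set gs" "m \<in> set (raw2 f g)"
    using assms(3,4) by (auto simp: C raw_gate_def split: if_splits)
  obtain c' hs where h: "g = Gate2 c' hs" by (cases g)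
  have "good_mono L m" if "m \<in> set (bit_raw f' ds)" "f' \<in> {1, 2}" for L f' ds
    using that by (induction f' ds rule: bit_raw.induct) (auto simp: good_mono_def split: if_splits)
  moreover have "good_mono (2 * N) m" if "x \<in> set hs" "m \<in> set (raw1 f x)" for x
  proof -
    obtain c'' es where x: "x = Gate1 c'' es" by (cases x)
    have "length es = n" using assms(1) C g h that x by fastforce
    moreover have "n \<le> N"
      using inputs_le_enc[of n c gs c' hs x] assms(1,2) C g h that by simp
    ultimately show ?thesis
      using that assms(5) x by (cases "even c''") (auto simp: good_mono_def)
  qed
  ultimately show ?thesis using g(2) h assms(5) by auto
qed

theorem theorem7p3:
  fixes \<alpha> :: "'f::field"
  assumes "card (UNIV :: 'f set) = 4"
    and "primitive_element \<alpha>"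
  shows "polytime_reducible cc232_equivalence (poly_exp_sum_zero \<alpha>)"
proof -
  have good: "\<forall>ms\<in>set (raw_pass 1 C @ raw_pass 2 C). \<forall>m\<in>set ms. good_mono (2 * length (enc_circuit C)) m"
    if "wf_circuit C" for C
    using good_raw[OF that refl] by auto
  have len: "length (concat (raw_pass 1 C @ raw_pass 2 C)) \<le> 2 * length (enc_circuit C)" for C
    using length_raw_pass[of 1 C] length_raw_pass[of 2 C] by simp
  have inst: "reduction C \<in> instances (poly_exp_sum_zero \<alpha>)" if "wf_circuit C" for C
    using wf_numbered_system[OF good[OF that], of 0] len[of C]
    by (simp add: poly_exp_sum_zero_def reduction_def Let_def)
  have comp: "computes_within (machine 4 6 main_com) (enc_circuit C) (enc_poly_system (reduction C))
      (poly [:190, 654, 384:] (length (enc_circuit C)))" if wf: "wf_circuit C" for C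
  proof -
    define N where "N = length (enc_circuit C)"
    obtain i u f where "exec main_com [([], enc_circuit C), ([], []), ([], []), ([], [])] (384 * N * N + 654 * N + 190)
        [i, u, f, ([0], enc_poly_system (reduction C) @ [0])]"
      using exec_main[OF wf N_def] by blast
    moreover have "384 * N * N + 654 * N + 190 = poly [:190, 654, 384:] N"
      by (simp add: algebra_simps)
    moreover have "[([], enc_circuit C), ([], []), ([], []), ([], [])] = ([], enc_circuit C) # replicate (4 - 1) (([], []) :: zipper)"
      by (simp add: numeral_3_eq_3)
    ultimately have "exec main_com (([], enc_circuit C) # replicate (4 - 1) ([], [])) (poly [:190, 654, 384:] N)
        [i, u, f, ([0], enc_poly_system (reduction C) @ [0])]"
      by (simp only:)
    moreover have "0 \<notin> set (enc_poly_system (reduction C))"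
      using set_enc_poly_system[of "reduction C"] by auto
    ultimately show ?thesis
      unfolding N_def by (intro machine_computes[OF _ wf_main_com _ _ _ set_enc_circuit]) auto
  qed
  have iff: "holds cc232_equivalence C \<longleftrightarrow> holds (poly_exp_sum_zero \<alpha>) (reduction C)" if wf: "wf_circuit C" for C
  proof -
    obtain n c gs where C: "C = Circuit n c gs" by (cases C)
    define N where "N = length (enc_circuit C)"
    define val where "val a = (\<Sum>p\<leftarrow>snd (reduction C). \<alpha> ^ nat (eval_expanded p a))" for a
    have key: "val a = 0 \<longleftrightarrow> eval_circuit y C = 1"
      if "length a = 4 * N" "set a \<subseteq> {-1, 1}" "n \<le> 4 * N \<Longrightarrow> \<forall>m<n. a ! m = (-1) ^ (y ! m)" for a y
      unfolding val_def
      by (rule reduction_correct[OF assms C wf N_def that good[OF wf, folded N_def] len[of C, folded N_def]])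
    have "(\<forall>y. length y = n \<and> set y \<subseteq> {0, 1} \<longrightarrow> eval_circuit y C = 1) \<longleftrightarrow>
        (\<forall>a. length a = 4 * N \<and> set a \<subseteq> {-1, 1} \<longrightarrow> val a = 0)" (is "?A \<longleftrightarrow> ?B")
    proof
      assume A: ?A
      show ?B
      proof (intro allI impI)
        fix a :: "int list" assume a: "length a = 4 * N \<and> set a \<subseteq> {-1, 1}"
        \<comment> \<open>Inputs without a variable, which occur only for \<open>n > 4 * N\<close>,
          get the default 0.\<close>
        define y where "y = map (\<lambda>m. if m < 4 * N \<and> a ! m = -1 then 1 else 0 :: nat) [0..<n]"
        have "a ! m = (-1) ^ (y ! m)" if "n \<le> 4 * N" "m < n" for m
        proof -
          have "a ! m \<in> set a" using a that by simp
          then have "a ! m \<in> {-1, 1}" using a by blast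
          then show ?thesis using that by (auto simp: y_def)
        qed
        moreover have "length y = n \<and> set y \<subseteq> {0, 1}" by (auto simp: y_def)
        then have "eval_circuit y C = 1" using A by blast
        ultimately show "val a = 0" using key a by blast
      qed
    next
      assume B: ?B
      show ?A
      proof (intro allI impI)
        fix y :: "nat list" assume y: "length y = n \<and> set y \<subseteq> {0, 1}"
        \<comment> \<open>Variables with index at least \<open>n\<close> get the default 1.\<close>
        define a where "a = map (\<lambda>m. if m < n \<and> y ! m = 1 then -1 else 1 :: int) [0..<4 * N]"
        have "a ! m = (-1) ^ (y ! m)" if "n \<le> 4 * N" "m < n" for m
        proof -
          have "y ! m \<in> set y" using y that by simp
          then have "y ! m \<in> {0, 1}" using y by blast
          then show ?thesis using that by (auto simp: a_def)
        qed
        moreover have "length a = 4 * N" "set a \<subseteq> {-1, 1}" by (auto simp: a_def)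
        ultimately show "eval_circuit y C = 1" using key B by blast
      qed
    qed
    moreover have "holds (poly_exp_sum_zero \<alpha>) (4 * N, snd (reduction C)) \<longleftrightarrow>
        (\<forall>a. length a = 4 * N \<and> set a \<subseteq> {-1, 1} \<longrightarrow> val a = 0)"
      by (simp add: poly_exp_sum_zero_def val_def)
    moreover have "(4 * N, snd (reduction C)) = reduction C" by (simp add: reduction_def N_def Let_def)
    moreover have "holds cc232_equivalence C \<longleftrightarrow> (\<forall>y. length y = n \<and> set y \<subseteq> {0, 1} \<longrightarrow> eval_circuit y C = 1)"
      by (simp add: cc232_equivalence_def C)
    ultimately show ?thesis by simp
  qed
  have "polytime_transformation cc232_equivalence (poly_exp_sum_zero \<alpha>) reduction"
    unfolding polytime_transformation_def
  proof (intro conjI exI)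
    show "wf_tm (machine 4 6 main_com)" by (rule machine_wf[OF wf_main_com]) auto
    show "\<forall>e\<in>instances cc232_equivalence. computes_within (machine 4 6 main_com) (encode cc232_equivalence e)
        (encode (poly_exp_sum_zero \<alpha>) (reduction e)) (poly [:190, 654, 384:] (length (encode cc232_equivalence e)))"
      using comp by (simp add: cc232_equivalence_def poly_exp_sum_zero_def)
  qed (use inst in \<open>simp add: cc232_equivalence_def\<close>)
  then show ?thesis
    unfolding polytime_reducible_def
    using iff by (intro exI[of _ reduction]) (simp add: cc232_equivalence_def)
qed

end
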